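(* Let $\Bbbk$ be a field, let $\mathbf c\in\mathbb Z^{n+1}$, and let $\mathcal A\subset\mathbb N^{n+1}$ be a finite set with $N+1$ elements which generates a convex cone in $\mathbb R^{n+1}$ containing all of $\mathbb N^{n+1}$. Let $$\mathbf t=\sum_{\mathbf a\in\mathcal A}\mathbf a,\qquad \check{\mathbf c}=\mathbf t-\mathbf c-(1,\ldots,1).$$ Then, for every integer $i$, $$\tilde H_{i-1}(\Gamma_{\mathbf c}(\mathcal A);\Bbbk)\cong\tilde H_{N-n-i-1}(\Gamma_{\check{\mathbf c}}(\mathcal A);\Bbbk)^*.$$
   Context: Convention: $0\in\mathbb N$. The partial order on $\mathbb Z^{n+1}$ is $\mathbf a\ge\mathbf b$ iff $\mathbf a-\mathbf b\in\mathbb N^{n+1}$. The convex cone generated by $\mathcal A$ is the set of nonnegative real linear combinations of elements of $\mathcal A$. For a finite $\mathcal A\subset\mathbb N^{n+1}$ and $\mathbf c\in\mathbb Z^{n+1}$, the pile complex is the abstract simplicial complex on the vertex set $\mathcal A$ $$\Gamma_{\mathbf c}(\mathcal A)=\Big\{\mathcal S\subseteq\mathcal A\ \Big|\ \sum_{\mathbf a\in\mathcal S}\mathbf a\le\mathbf c\Big\}.$$ Reduced simplicial homology conventions: the void complex $\varnothing$ (no faces at all, which occurs when $\mathbf c\not\ge\mathbf 0$) has $\tilde H_i(\varnothing;\Bbbk)=0$ for all $i$; the complex $\{\varnothing\}$ whose only face is the empty face has $\tilde H_{-1}=\Bbbk$ and $\tilde H_i=0$ for $i\ne-1$. The superscript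 $*$ denotes the dual $\Bbbk$-vector space. *)

theory Defs
  imports "HOL-Analysis.Analysis" "HOL-Algebra.Algebraic_Closure_Type"
begin

no_notation fps_nth (infixl \<open>$\<close> 75)

section \<open>Quotients, duals and isomorphisms of modules\<close>

text \<open>The ring operations \<open>mult\<close> and \<open>one\<close> that a module record inherits play no role for a
  module and are left unspecified.\<close>

definition quotient_module ::
    "('r, 'a, 'c) module_scheme \<Rightarrow> 'a set \<Rightarrow> ('r, 'a set) module" where
  "quotient_module M B =
    \<lparr>carrier = a_rcosets\<^bsub>M\<^esub> B, monoid.mult = undefined, one = undefined,
     ring.zero = B, add = set_add M,
     smult = (\<lambda>c C. \<Union>x\<in>C. B +>\<^bsub>M\<^esub> (c \<odot>\<^bsub>M\<^esub> x))\<rparr>"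

definition linear_maps ::
    "('r, 'm) ring_scheme \<Rightarrow> ('r, 'a, 'c) module_scheme \<Rightarrow> ('r, 'b, 'd) module_scheme \<Rightarrow> ('a \<Rightarrow> 'b) set"
  where
  "linear_maps R M N = {f \<in> carrier M \<rightarrow> carrier N.
     (\<forall>x\<in>carrier M. \<forall>y\<in>carrier M. f (x \<oplus>\<^bsub>M\<^esub> y) = f x \<oplus>\<^bsub>N\<^esub> f y) \<and>
     (\<forall>c\<in>carrier R. \<forall>x\<in>carrier M. f (c \<odot>\<^bsub>M\<^esub> x) = c \<odot>\<^bsub>N\<^esub> f x)}"

definition module_isomorphic ::
    "('r, 'm) ring_scheme \<Rightarrow> ('r, 'a, 'c) module_scheme \<Rightarrow> ('r, 'b, 'd) module_scheme \<Rightarrow> bool" where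
  "module_isomorphic R M N \<longleftrightarrow>
     (\<exists>f \<in> linear_maps R M N. bij_betw f (carrier M) (carrier N))"

definition self_module :: "('r, 'm) ring_scheme \<Rightarrow> ('r, 'r) module" where
  "self_module R =
    \<lparr>carrier = carrier R, monoid.mult = undefined, one = undefined,
     ring.zero = \<zero>\<^bsub>R\<^esub>, add = add R, smult = monoid.mult R\<rparr>"

text \<open>Functionals are normalised to be \<^const>\<open>undefined\<close> off the carrier of \<open>M\<close>, so that equality
  of functionals is equality on \<open>M\<close>.\<close>

definition dual_module ::
    "('r, 'm) ring_scheme \<Rightarrow> ('r, 'a, 'c) module_scheme \<Rightarrow> ('r, 'a \<Rightarrow> 'r) module" where
  "dual_module R M =
    \<lparr>carrier = linear_maps R M (self_module R) \<inter> extensional (carrier M),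
     monoid.mult = undefined, one = undefined,
     ring.zero = (\<lambda>x\<in>carrier M. \<zero>\<^bsub>R\<^esub>),
     add = (\<lambda>f g. \<lambda>x\<in>carrier M. f x \<oplus>\<^bsub>R\<^esub> g x),
     smult = (\<lambda>c f. \<lambda>x\<in>carrier M. c \<otimes>\<^bsub>R\<^esub> f x)\<rparr>"

lemma module_quotient_module:
  assumes M: "Module.module R M"
    and sub: "B \<subseteq> carrier M" and zeroB: "\<zero>\<^bsub>M\<^esub> \<in> B"
    and addB: "\<And>x y. x \<in> B \<Longrightarrow> y \<in> B \<Longrightarrow> x \<oplus>\<^bsub>M\<^esub> y \<in> B"
    and smultB: "\<And>c x. c \<in> carrier R \<Longrightarrow> x \<in> B \<Longrightarrow> c \<odot>\<^bsub>M\<^esub> x \<in> B"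
  shows "Module.module R (quotient_module M B)"
proof -
  interpret Module.module R M by fact
  have neg: "\<ominus>\<^bsub>M\<^esub> x \<in> B" if "x \<in> B" for x
  proof -
    have "\<ominus>\<^bsub>M\<^esub> x = (\<ominus>\<^bsub>R\<^esub> \<one>\<^bsub>R\<^esub>) \<odot>\<^bsub>M\<^esub> x"
      using that sub by (auto simp: smult_l_minus)
    then show ?thesis using smultB that by simp
  qed
  have "subgroup B (add_monoid M)"
  proof (rule M.add.subgroupI)
    show "B \<noteq> {}" using zeroB by blast
  qed (use sub addB neg in \<open>auto simp: a_inv_def\<close>)
  then interpret B: abelian_subgroup B M
    by (intro abelian_subgroupI3 additive_subgroup.intro M.abelian_group_axioms)
  have coset_smult: "(\<Union>x\<in>B +>\<^bsub>M\<^esub> a. B +>\<^bsub>M\<^esub> (c \<odot>\<^bsub>M\<^esub> x)) = B +>\<^bsub>M\<^esub> (c \<odot>\<^bsub>M\<^esub> a)"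
    if "a \<in> carrier M" "c \<in> carrier R" for a c
  proof -
    have "B +>\<^bsub>M\<^esub> (c \<odot>\<^bsub>M\<^esub> x) = B +>\<^bsub>M\<^esub> (c \<odot>\<^bsub>M\<^esub> a)" if x: "x \<in> B +>\<^bsub>M\<^esub> a" for x
    proof -
      from x obtain b where b: "b \<in> B" "x = b \<oplus>\<^bsub>M\<^esub> a"
        by (auto simp: a_r_coset_def')
      then have "c \<odot>\<^bsub>M\<^esub> x \<in> B +>\<^bsub>M\<^esub> (c \<odot>\<^bsub>M\<^esub> a)"
        using \<open>a \<in> carrier M\<close> \<open>c \<in> carrier R\<close> smultB[of c b] sub
        by (auto simp: a_r_coset_def' smult_r_distr)
      then show ?thesis
        using \<open>a \<in> carrier M\<close> \<open>c \<in> carrier R\<close> B.a_repr_independence' by fastforce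
    qed
    moreover have "a \<in> B +>\<^bsub>M\<^esub> a"
      using zeroB that by (auto simp: a_r_coset_def' intro!: bexI[of _ "\<zero>\<^bsub>M\<^esub>"])
    ultimately show ?thesis by blast
  qed
  have coset_add: "(B +>\<^bsub>M\<^esub> a) <+>\<^bsub>M\<^esub> (B +>\<^bsub>M\<^esub> b) = B +>\<^bsub>M\<^esub> (a \<oplus>\<^bsub>M\<^esub> b)"
    if "a \<in> carrier M" "b \<in> carrier M" for a b
    using that by (rule B.a_rcos_sum)
  have cosets: "C \<in> a_rcosets\<^bsub>M\<^esub> B \<longleftrightarrow> (\<exists>a\<in>carrier M. C = B +>\<^bsub>M\<^esub> a)" for C
    by (auto simp: A_RCOSETS_def')
  have B0: "B = B +>\<^bsub>M\<^esub> \<zero>\<^bsub>M\<^esub>"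
    using sub by (simp add: M.a_coset_add_zero)
  show ?thesis
  proof (rule moduleI)
    show "cring R" by (rule R.is_cring)
    show "abelian_group (quotient_module M B)"
    proof (rule abelian_groupI, goal_cases)
      case (1 x y)
      then show ?case by (auto simp: quotient_module_def cosets coset_add)
    next
      case 2
      then show ?case using B0 by (auto simp: quotient_module_def cosets)
    next
      case (3 x y z)
      then show ?case by (auto simp: quotient_module_def cosets coset_add M.a_assoc)
    next
      case (4 x y)
      then show ?case by (auto simp: quotient_module_def cosets coset_add M.a_comm)
    next
      case (5 x)
      then obtain a where a: "a \<in> carrier M" "x = B +>\<^bsub>M\<^esub> a"
        by (auto simp: quotient_module_def cosets)
      then show ?case
        using coset_add[of "\<zero>\<^bsub>M\<^esub>" a] B0 by (simp add: quotient_module_def)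
    next
      case (6 x)
      then obtain a where a: "a \<in> carrier M" "x = B +>\<^bsub>M\<^esub> a"
        by (auto simp: quotient_module_def cosets)
      then have "(B +>\<^bsub>M\<^esub> (\<ominus>\<^bsub>M\<^esub> a)) <+>\<^bsub>M\<^esub> x = B"
        using B0 by (simp add: coset_add M.l_neg)
      then show ?case
        using a by (intro bexI[of _ "B +>\<^bsub>M\<^esub> (\<ominus>\<^bsub>M\<^esub> a)"]) (auto simp: quotient_module_def cosets)
    qed
  next
    fix c x assume c: "c \<in> carrier R" and "x \<in> carrier (quotient_module M B)"
    then obtain a where a: "a \<in> carrier M" "x = B +>\<^bsub>M\<^esub> a"
      by (auto simp: quotient_module_def cosets)
    have sm: "d \<odot>\<^bsub>quotient_module M B\<^esub> (B +>\<^bsub>M\<^esub> b) = B +>\<^bsub>M\<^esub> (d \<odot>\<^bsub>M\<^esub> b)"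
      if "b \<in> carrier M" "d \<in> carrier R" for b d
      using coset_smult[OF that] by (simp add: quotient_module_def)
    have ad: "(B +>\<^bsub>M\<^esub> b) \<oplus>\<^bsub>quotient_module M B\<^esub> (B +>\<^bsub>M\<^esub> b') = B +>\<^bsub>M\<^esub> (b \<oplus>\<^bsub>M\<^esub> b')"
      if "b \<in> carrier M" "b' \<in> carrier M" for b b'
      using coset_add[OF that] by (simp add: quotient_module_def)
    show "c \<odot>\<^bsub>quotient_module M B\<^esub> x \<in> carrier (quotient_module M B)"
      unfolding a(2) sm[OF a(1) c] using smult_closed[OF c a(1)]
      by (auto simp: quotient_module_def cosets)
    fix d assume d: "d \<in> carrier R"
    show "(c \<oplus>\<^bsub>R\<^esub> d) \<odot>\<^bsub>quotient_module M B\<^esub> x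
        = c \<odot>\<^bsub>quotient_module M B\<^esub> x \<oplus>\<^bsub>quotient_module M B\<^esub> d \<odot>\<^bsub>quotient_module M B\<^esub> x"
      using a c d by (simp add: sm ad smult_l_distr)
    show "(c \<otimes>\<^bsub>R\<^esub> d) \<odot>\<^bsub>quotient_module M B\<^esub> x
        = c \<odot>\<^bsub>quotient_module M B\<^esub> (d \<odot>\<^bsub>quotient_module M B\<^esub> x)"
      using a c d by (simp add: sm smult_assoc1)
  next
    fix c x y assume c: "c \<in> carrier R"
      and "x \<in> carrier (quotient_module M B)" "y \<in> carrier (quotient_module M B)"
    then obtain a b where "a \<in> carrier M" "x = B +>\<^bsub>M\<^esub> a" "b \<in> carrier M" "y = B +>\<^bsub>M\<^esub> b"
      by (auto simp: quotient_module_def cosets)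
    then show "c \<odot>\<^bsub>quotient_module M B\<^esub> (x \<oplus>\<^bsub>quotient_module M B\<^esub> y)
        = c \<odot>\<^bsub>quotient_module M B\<^esub> x \<oplus>\<^bsub>quotient_module M B\<^esub> c \<odot>\<^bsub>quotient_module M B\<^esub> y"
      using c coset_smult[of a c] coset_smult[of b c] coset_smult[of "a \<oplus>\<^bsub>M\<^esub> b" c]
      by (simp add: quotient_module_def coset_add smult_r_distr)
  next
    fix x assume "x \<in> carrier (quotient_module M B)"
    then obtain a where a: "a \<in> carrier M" "x = B +>\<^bsub>M\<^esub> a"
      by (auto simp: quotient_module_def cosets)
    show "\<one>\<^bsub>R\<^esub> \<odot>\<^bsub>quotient_module M B\<^esub> x = x"
      using coset_smult[OF a(1) R.one_closed] a by (simp add: quotient_module_def)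
  qed
qed

lemma module_dual_module:
  assumes M: "Module.module R M"
  shows "Module.module R (dual_module R M)"
proof -
  interpret Module.module R M by fact
  show ?thesis
  proof (rule moduleI)
    show "cring R" by (rule R.is_cring)
    show "abelian_group (dual_module R M)"
    proof (rule abelian_groupI)
      fix f assume "f \<in> carrier (dual_module R M)"
      then show "\<exists>g\<in>carrier (dual_module R M).
          g \<oplus>\<^bsub>dual_module R M\<^esub> f = \<zero>\<^bsub>dual_module R M\<^esub>"
        by (intro bexI[of _ "\<lambda>x\<in>carrier M. \<ominus>\<^bsub>R\<^esub> f x"])
          (auto simp: dual_module_def linear_maps_def self_module_def Pi_iff R.l_neg
             R.minus_add R.r_minus intro!: restrict_ext)
    qed (auto simp: dual_module_def linear_maps_def self_module_def Pi_iff extensional_def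
           R.a_ac R.r_distr fun_eq_iff)
  qed (auto simp: dual_module_def linear_maps_def self_module_def Pi_iff extensional_def
         R.a_ac R.m_ac R.l_distr R.r_distr fun_eq_iff)
qed


section \<open>Reduced simplicial homology over a field\<close>

text \<open>A simplicial complex is the set \<open>\<Delta>\<close> of its faces, the empty face included unless
  \<open>\<Delta>\<close> is void. An \<open>i\<close>-chain is its coefficient function; its orientation conventions come from a linear
  order \<open>r\<close> of the vertices.\<close>

definition simplicial_chains :: "'v set set \<Rightarrow> int \<Rightarrow> ('v set \<Rightarrow> 'k::field) set" where
  "simplicial_chains \<Delta> i = {f. finite {\<sigma>. f \<sigma> \<noteq> 0} \<and>
     (\<forall>\<sigma>. f \<sigma> \<noteq> 0 \<longrightarrow> \<sigma> \<in> \<Delta> \<and> finite \<sigma> \<and> int (card \<sigma>) = i + 1)}"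

definition boundary_simplex :: "'v rel \<Rightarrow> 'v set \<Rightarrow> ('v set \<Rightarrow> 'k::field)" where
  "boundary_simplex r \<sigma> = (\<lambda>\<tau>. \<Sum>v\<in>\<sigma>.
     if \<tau> = \<sigma> - {v} then (- 1) ^ card {u \<in> \<sigma>. u \<noteq> v \<and> (u, v) \<in> r} else 0)"

definition boundary :: "'v rel \<Rightarrow> ('v set \<Rightarrow> 'k::field) \<Rightarrow> ('v set \<Rightarrow> 'k)" where
  "boundary r f = (\<lambda>\<tau>. \<Sum>\<sigma> | f \<sigma> \<noteq> 0. f \<sigma> * boundary_simplex r \<sigma> \<tau>)"

definition simplicial_cycles :: "'v rel \<Rightarrow> 'v set set \<Rightarrow> int \<Rightarrow> ('v set \<Rightarrow> 'k::field) set" where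
  "simplicial_cycles r \<Delta> i = {f \<in> simplicial_chains \<Delta> i. boundary r f = (\<lambda>_. 0)}"

definition simplicial_boundaries :: "'v rel \<Rightarrow> 'v set set \<Rightarrow> int \<Rightarrow> ('v set \<Rightarrow> 'k::field) set" where
  "simplicial_boundaries r \<Delta> i = boundary r ` simplicial_chains \<Delta> (i + 1)"

definition cycle_module ::
    "'v rel \<Rightarrow> 'v set set \<Rightarrow> int \<Rightarrow> ('k::field, 'v set \<Rightarrow> 'k) module" where
  "cycle_module r \<Delta> i =
    \<lparr>carrier = simplicial_cycles r \<Delta> i, monoid.mult = undefined, one = undefined,
     ring.zero = (\<lambda>_. 0), add = (\<lambda>f g \<sigma>. f \<sigma> + g \<sigma>), smult = (\<lambda>c f \<sigma>. c * f \<sigma>)\<rparr>"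

definition reduced_homology ::
    "'v rel \<Rightarrow> 'v set set \<Rightarrow> int \<Rightarrow> ('k::field, ('v set \<Rightarrow> 'k) set) module" where
  "reduced_homology r \<Delta> i = quotient_module (cycle_module r \<Delta> i) (simplicial_boundaries r \<Delta> i)"

lemma boundary_eq_sum:
  assumes "finite F" "{\<sigma>. f \<sigma> \<noteq> 0} \<subseteq> F"
  shows "boundary r f \<tau> = (\<Sum>\<sigma>\<in>F. f \<sigma> * boundary_simplex r \<sigma> \<tau>)"
  unfolding boundary_def by (rule sum.mono_neutral_left) (use assms in auto)

lemma boundary_simplex_nonzeroD:
  assumes "boundary_simplex r \<sigma> \<tau> \<noteq> (0::'k::field)"
  shows "\<exists>v\<in>\<sigma>. \<tau> = \<sigma> - {v}"
proof (rule ccontr)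
  assume "\<not> (\<exists>v\<in>\<sigma>. \<tau> = \<sigma> - {v})"
  then have "boundary_simplex r \<sigma> \<tau> = (0::'k)"
    unfolding boundary_simplex_def by (intro sum.neutral) auto
  with assms show False by contradiction
qed

lemma boundary_support:
  assumes "finite {\<sigma>. f \<sigma> \<noteq> 0}"
  shows "{\<tau>. boundary r f \<tau> \<noteq> 0} \<subseteq> (\<Union>\<sigma>\<in>{\<sigma>. f \<sigma> \<noteq> 0}. (\<lambda>v. \<sigma> - {v}) ` \<sigma>)"
proof
  fix \<tau> assume "\<tau> \<in> {\<tau>. boundary r f \<tau> \<noteq> 0}"
  then obtain \<sigma> where "f \<sigma> \<noteq> 0" "boundary_simplex r \<sigma> \<tau> \<noteq> (0::'b)"
    unfolding boundary_def by (auto elim: sum.not_neutral_contains_not_neutral)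
  then show "\<tau> \<in> (\<Union>\<sigma>\<in>{\<sigma>. f \<sigma> \<noteq> 0}. (\<lambda>v. \<sigma> - {v}) ` \<sigma>)"
    using boundary_simplex_nonzeroD by fastforce
qed

lemma boundary_chains:
  assumes "f \<in> simplicial_chains \<Delta> (i + 1)" and down: "\<And>\<sigma> \<tau>. \<sigma> \<in> \<Delta> \<Longrightarrow> \<tau> \<subseteq> \<sigma> \<Longrightarrow> \<tau> \<in> \<Delta>"
  shows "boundary r f \<in> simplicial_chains \<Delta> i"
proof -
  have fin: "finite {\<sigma>. f \<sigma> \<noteq> 0}"
    and f: "\<And>\<sigma>. f \<sigma> \<noteq> 0 \<Longrightarrow> \<sigma> \<in> \<Delta> \<and> finite \<sigma> \<and> int (card \<sigma>) = i + 2"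
    using assms(1) by (auto simp: simplicial_chains_def)
  have "finite {\<tau>. boundary r f \<tau> \<noteq> 0}"
    by (rule finite_subset[OF boundary_support[OF fin]]) (use fin f in auto)
  moreover have "\<tau> \<in> \<Delta> \<and> finite \<tau> \<and> int (card \<tau>) = i + 1" if nz: "boundary r f \<tau> \<noteq> 0" for \<tau>
  proof -
    have "\<tau> \<in> (\<Union>\<sigma>\<in>{\<sigma>. f \<sigma> \<noteq> 0}. (\<lambda>v. \<sigma> - {v}) ` \<sigma>)"
      by (rule subsetD[OF boundary_support[OF fin, of r]]) (use nz in simp)
    then obtain \<sigma> v where s: "f \<sigma> \<noteq> 0" "v \<in> \<sigma>" "\<tau> = \<sigma> - {v}"
      by auto
    have "card \<sigma> = Suc (card \<tau>)"
      using s f[of \<sigma>] by (metis card_Suc_Diff1)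
    then show ?thesis using s f[of \<sigma>] down[of \<sigma> \<tau>] by auto
  qed
  ultimately show ?thesis by (auto simp: simplicial_chains_def)
qed

lemma boundary_simplex_twice:
  fixes \<rho> :: "'v set"
  assumes r: "linear_order_on V r" and "finite \<sigma>" "\<sigma> \<subseteq> V"
  shows "(\<Sum>v\<in>\<sigma>. (- 1) ^ card {u \<in> \<sigma>. u \<noteq> v \<and> (u, v) \<in> r} * boundary_simplex r (\<sigma> - {v}) \<rho>)
    = (0::'k::field)"
proof -
  define s where "s v \<sigma> = ((- 1) ^ card {u \<in> \<sigma>. u \<noteq> v \<and> (u, v) \<in> r} :: 'k)" for v \<sigma>
  define g where "g v w = (if \<rho> = \<sigma> - {v} - {w} then s v \<sigma> * s w (\<sigma> - {v}) else 0)" for v w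
  define P where "P = {(v, w). v \<in> \<sigma> \<and> w \<in> \<sigma> \<and> v \<noteq> w \<and> (v, w) \<in> r}"
  have finP: "finite P"
    by (rule finite_subset[of _ "\<sigma> \<times> \<sigma>"]) (use assms in \<open>auto simp: P_def\<close>)
  have tot: "(v, w) \<in> r \<or> (w, v) \<in> r" if "v \<in> \<sigma>" "w \<in> \<sigma>" "v \<noteq> w" for v w
    using r that \<open>\<sigma> \<subseteq> V\<close> by (auto simp: linear_order_on_def total_on_def)
  have anti: "\<not> ((v, w) \<in> r \<and> (w, v) \<in> r)" if "v \<noteq> w" for v w
    using r that by (auto simp: linear_order_on_def partial_order_on_def antisym_def)
  have disj: "P \<inter> prod.swap ` P = {}"
  proof (intro equals0I)
    fix p assume p: "p \<in> P \<inter> prod.swap ` P"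
    obtain v w where vw: "p = (v, w)" by force
    with p have "v \<noteq> w" "(v, w) \<in> r" "(w, v) \<in> r" by (auto simp: P_def)
    then show False using anti[of v w] by blast
  qed
  have swap: "g v w = - g w v" if "(v, w) \<in> P" for v w
  proof -
    from that have vw: "v \<in> \<sigma>" "w \<in> \<sigma>" "v \<noteq> w" "(v, w) \<in> r" by (auto simp: P_def)
    have "{u \<in> \<sigma>. u \<noteq> w \<and> (u, w) \<in> r} = insert v {u \<in> \<sigma> - {v}. u \<noteq> w \<and> (u, w) \<in> r}"
      using vw by auto
    then have 1: "s w \<sigma> = - s w (\<sigma> - {v})"
      unfolding s_def using \<open>finite \<sigma>\<close> by simp
    have "{u \<in> \<sigma> - {w}. u \<noteq> v \<and> (u, v) \<in> r} = {u \<in> \<sigma>. u \<noteq> v \<and> (u, v) \<in> r}"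
      using vw anti[of v w] by auto
    then have 2: "s v (\<sigma> - {w}) = s v \<sigma>"
      by (simp add: s_def)
    have "\<sigma> - {v} - {w} = \<sigma> - {w} - {v}" by auto
    then show ?thesis by (simp add: g_def 1 2)
  qed
  have "(\<Sum>v\<in>\<sigma>. s v \<sigma> * boundary_simplex r (\<sigma> - {v}) \<rho>) = (\<Sum>v\<in>\<sigma>. \<Sum>w\<in>\<sigma> - {v}. g v w)"
    unfolding boundary_simplex_def g_def s_def[symmetric]
    by (auto simp: sum_distrib_left if_distrib[of "\<lambda>x. _ * x"] cong: if_cong intro!: sum.cong)
  also have "\<dots> = (\<Sum>(v, w)\<in>Sigma \<sigma> (\<lambda>v. \<sigma> - {v}). g v w)"
    using \<open>finite \<sigma>\<close> by (simp add: sum.Sigma)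
  also have "Sigma \<sigma> (\<lambda>v. \<sigma> - {v}) = P \<union> prod.swap ` P"
  proof (intro subset_antisym subsetI)
    fix p assume p: "p \<in> Sigma \<sigma> (\<lambda>v. \<sigma> - {v})"
    then show "p \<in> P \<union> prod.swap ` P"
      using tot[of "fst p" "snd p"] by (cases p) (auto simp: P_def image_iff)
  qed (auto simp: P_def)
  also have "(\<Sum>(v, w)\<in>P \<union> prod.swap ` P. g v w)
      = (\<Sum>(v, w)\<in>P. g v w) + (\<Sum>(v, w)\<in>prod.swap ` P. g v w)"
    using finP disj by (simp add: sum.union_disjoint)
  also have "(\<Sum>(v, w)\<in>prod.swap ` P. g v w) = (\<Sum>(v, w)\<in>P. g w v)"
    by (subst sum.reindex) (auto simp: case_prod_unfold intro: sum.cong)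
  also have "(\<Sum>(v, w)\<in>P. g v w) = (\<Sum>(v, w)\<in>P. - g w v)"
    by (rule sum.cong) (use swap in auto)
  also have "(\<Sum>(v, w)\<in>P. - g w v) + (\<Sum>(v, w)\<in>P. g w v) = 0"
    by (simp add: case_prod_unfold sum_negf)
  finally show ?thesis by (simp add: s_def)
qed

lemma boundary_boundary:
  fixes f :: "'v set \<Rightarrow> 'k::field"
  assumes r: "linear_order_on V r" and V: "\<Union>\<Delta> \<subseteq> V" and f: "f \<in> simplicial_chains \<Delta> i"
  shows "boundary r (boundary r f) = (\<lambda>_. 0)"
proof
  fix \<rho>
  define F where "F = {\<sigma>. f \<sigma> \<noteq> 0}"
  define T where "T = (\<Union>\<sigma>\<in>F. (\<lambda>v. \<sigma> - {v}) ` \<sigma>)"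
  have fin: "finite F" and F: "\<And>\<sigma>. \<sigma> \<in> F \<Longrightarrow> finite \<sigma> \<and> \<sigma> \<subseteq> V"
    using f V by (auto simp: F_def simplicial_chains_def)
  then have "finite T" by (auto simp: T_def)
  have "boundary r (boundary r f) \<rho>
      = (\<Sum>\<tau>\<in>T. (\<Sum>\<sigma>\<in>F. f \<sigma> * boundary_simplex r \<sigma> \<tau>) * boundary_simplex r \<tau> \<rho>)"
    by (subst boundary_eq_sum[OF \<open>finite T\<close>])
      (use boundary_support[of f r] fin in \<open>auto simp: T_def F_def boundary_def\<close>)
  also have "\<dots> = (\<Sum>\<sigma>\<in>F. f \<sigma> * (\<Sum>\<tau>\<in>T. boundary_simplex r \<sigma> \<tau> * boundary_simplex r \<tau> \<rho>))"
    by (simp add: sum_distrib_left sum_distrib_right mult.assoc)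
      (rule sum.swap)
  also have "\<dots> = 0"
  proof (rule sum.neutral, rule ballI)
    fix \<sigma> assume \<sigma>: "\<sigma> \<in> F"
    have "(\<Sum>\<tau>\<in>T. boundary_simplex r \<sigma> \<tau> * boundary_simplex r \<tau> \<rho>)
        = (\<Sum>v\<in>\<sigma>. \<Sum>\<tau>\<in>T. (if \<tau> = \<sigma> - {v} then (- 1) ^ card {u \<in> \<sigma>. u \<noteq> v \<and> (u, v) \<in> r} else 0)
             * boundary_simplex r \<tau> \<rho>)"
      unfolding boundary_simplex_def[of r \<sigma>] by (simp add: sum_distrib_right) (rule sum.swap)
    also have "\<dots> = (\<Sum>v\<in>\<sigma>. (- 1) ^ card {u \<in> \<sigma>. u \<noteq> v \<and> (u, v) \<in> r}
             * boundary_simplex r (\<sigma> - {v}) \<rho>)"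
    proof (rule sum.cong[OF refl])
      fix v assume "v \<in> \<sigma>"
      then have "\<sigma> - {v} \<in> T" using \<sigma> by (auto simp: T_def)
      then show "(\<Sum>\<tau>\<in>T. (if \<tau> = \<sigma> - {v} then (- 1) ^ card {u \<in> \<sigma>. u \<noteq> v \<and> (u, v) \<in> r} else 0)
             * boundary_simplex r \<tau> \<rho>)
          = (- 1) ^ card {u \<in> \<sigma>. u \<noteq> v \<and> (u, v) \<in> r} * boundary_simplex r (\<sigma> - {v}) \<rho>"
        using \<open>finite T\<close> by (simp add: if_distrib[of "\<lambda>x. x * _"] cong: if_cong)
    qed
    also have "\<dots> = 0" using boundary_simplex_twice[OF r] F[OF \<sigma>] by blast
    finally show "f \<sigma> * (\<Sum>\<tau>\<in>T. boundary_simplex r \<sigma> \<tau> * boundary_simplex r \<tau> \<rho>) = 0"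
      by (metis mult_zero_right)
  qed
  finally show "boundary r (boundary r f) \<rho> = 0" .
qed

lemma chains_add:
  assumes fg: "f \<in> simplicial_chains \<Delta> i" "g \<in> simplicial_chains \<Delta> i"
  shows "(\<lambda>\<sigma>. f \<sigma> + g \<sigma>) \<in> simplicial_chains \<Delta> i"
proof -
  have "{\<sigma>. f \<sigma> + g \<sigma> \<noteq> 0} \<subseteq> {\<sigma>. f \<sigma> \<noteq> 0} \<union> {\<sigma>. g \<sigma> \<noteq> 0}" by auto
  then show ?thesis
    using fg by (auto simp: simplicial_chains_def intro: finite_subset)
qed

lemma chains_smult: "f \<in> simplicial_chains \<Delta> i \<Longrightarrow> (\<lambda>\<sigma>. c * f \<sigma>) \<in> simplicial_chains \<Delta> i"
  by (auto simp: simplicial_chains_def elim!: rev_finite_subset)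

lemma boundary_add:
  assumes "f \<in> simplicial_chains \<Delta> i" "g \<in> simplicial_chains \<Delta> i"
  shows "boundary r (\<lambda>\<sigma>. f \<sigma> + g \<sigma>) = (\<lambda>\<tau>. boundary r f \<tau> + boundary r g \<tau>)"
proof
  fix \<tau>
  let ?F = "{\<sigma>. f \<sigma> \<noteq> 0} \<union> {\<sigma>. g \<sigma> \<noteq> 0}"
  have F: "finite ?F" using assms by (auto simp: simplicial_chains_def)
  show "boundary r (\<lambda>\<sigma>. f \<sigma> + g \<sigma>) \<tau> = boundary r f \<tau> + boundary r g \<tau>"
    by (subst (1 2 3) boundary_eq_sum[OF F]) (auto simp: sum.distrib distrib_right)
qed

lemma boundary_smult:
  assumes "f \<in> simplicial_chains \<Delta> i"
  shows "boundary r (\<lambda>\<sigma>. c * f \<sigma>) = (\<lambda>\<tau>. c * boundary r f \<tau>)"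
proof
  fix \<tau>
  have F: "finite {\<sigma>. f \<sigma> \<noteq> 0}" using assms by (auto simp: simplicial_chains_def)
  show "boundary r (\<lambda>\<sigma>. c * f \<sigma>) \<tau> = c * boundary r f \<tau>"
    by (subst (1 2) boundary_eq_sum[OF F]) (auto simp: sum_distrib_left mult.assoc)
qed

lemma zero_chain: "(\<lambda>_. 0) \<in> simplicial_chains \<Delta> i" "boundary r (\<lambda>_. 0) = (\<lambda>_. 0)"
  by (auto simp: simplicial_chains_def boundary_def)

lemma module_cycle_module:
  "Module.module (ring_of_type_algebra :: 'k::field ring)
     (cycle_module r \<Delta> i :: ('k, 'v set \<Rightarrow> 'k) module)"
proof (rule moduleI)
  show "abelian_group (cycle_module r \<Delta> i :: ('k, 'v set \<Rightarrow> 'k) module)"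
  proof (rule abelian_groupI)
    fix f :: "'v set \<Rightarrow> 'k"
    assume "f \<in> carrier (cycle_module r \<Delta> i)"
    then have f: "f \<in> simplicial_chains \<Delta> i" "boundary r f = (\<lambda>_. 0)"
      by (auto simp: cycle_module_def simplicial_cycles_def)
    show "\<exists>g\<in>carrier (cycle_module r \<Delta> i). g \<oplus>\<^bsub>cycle_module r \<Delta> i\<^esub> f = \<zero>\<^bsub>cycle_module r \<Delta> i\<^esub>"
      using chains_smult[OF f(1), of "- 1"] boundary_smult[OF f(1), of r "- 1"] f
      by (intro bexI[of _ "\<lambda>\<sigma>. (- 1) * f \<sigma>"]) (auto simp: cycle_module_def simplicial_cycles_def)
  qed (auto simp: cycle_module_def simplicial_cycles_def chains_add boundary_add zero_chain algebra_simps)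
qed (auto simp: cycle_module_def simplicial_cycles_def chains_smult boundary_smult zero_chain algebra_simps
      ring_of_type_algebra_def cring_from_type_algebra[unfolded ring_of_type_algebra_def])

lemma module_reduced_homology:
  assumes r: "linear_order_on V r" and V: "\<Union>\<Delta> \<subseteq> V"
    and down: "\<And>\<sigma> \<tau>. \<sigma> \<in> \<Delta> \<Longrightarrow> \<tau> \<subseteq> \<sigma> \<Longrightarrow> \<tau> \<in> \<Delta>"
  shows "Module.module (ring_of_type_algebra :: 'k::field ring)
     (reduced_homology r \<Delta> i :: ('k, ('v set \<Rightarrow> 'k) set) module)"
  unfolding reduced_homology_def
proof (rule module_quotient_module[OF module_cycle_module])
  show "simplicial_boundaries r \<Delta> i \<subseteq> carrier (cycle_module r \<Delta> i)"
    unfolding simplicial_boundaries_def cycle_module_def simplicial_cycles_def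
    by (auto simp: boundary_boundary[OF r V] intro: boundary_chains down)
  show "\<zero>\<^bsub>cycle_module r \<Delta> i\<^esub> \<in> simplicial_boundaries r \<Delta> i"
    unfolding simplicial_boundaries_def image_iff
    by (rule bexI[OF _ zero_chain(1)]) (simp add: cycle_module_def zero_chain)
next
  fix x y :: "'v set \<Rightarrow> 'k"
  assume "x \<in> simplicial_boundaries r \<Delta> i" "y \<in> simplicial_boundaries r \<Delta> i"
  then obtain f g where "f \<in> simplicial_chains \<Delta> (i + 1)" "g \<in> simplicial_chains \<Delta> (i + 1)"
    "x = boundary r f" "y = boundary r g" by (auto simp: simplicial_boundaries_def)
  then show "x \<oplus>\<^bsub>cycle_module r \<Delta> i\<^esub> y \<in> simplicial_boundaries r \<Delta> i"
    unfolding simplicial_boundaries_def image_iff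
    by (intro bexI[OF _ chains_add[of f \<Delta> "i + 1" g]]) (simp_all add: cycle_module_def boundary_add)
next
  fix c :: 'k and x :: "'v set \<Rightarrow> 'k"
  assume "x \<in> simplicial_boundaries r \<Delta> i"
  then obtain f where "f \<in> simplicial_chains \<Delta> (i + 1)" "x = boundary r f"
    by (auto simp: simplicial_boundaries_def)
  then show "c \<odot>\<^bsub>cycle_module r \<Delta> i\<^esub> x \<in> simplicial_boundaries r \<Delta> i"
    unfolding simplicial_boundaries_def image_iff
    by (intro bexI[OF _ chains_smult[of f \<Delta> "i + 1" c]]) (simp_all add: cycle_module_def boundary_smult)
qed


section \<open>Pile complexes\<close>

definition pile_complex :: "(int ^ 'd) set \<Rightarrow> int ^ 'd \<Rightarrow> (int ^ 'd) set set" where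
  "pile_complex A c = {S. S \<subseteq> A \<and> (\<Sum>a\<in>S. a) \<le> c}"

definition real_vec :: "int ^ 'd \<Rightarrow> real ^ 'd" where
  "real_vec a = (\<chi> j. real_of_int (a $ j))"

lemma pile_complex_down_closed:
  assumes "finite A" "\<And>a. a \<in> A \<Longrightarrow> 0 \<le> a" "S \<in> pile_complex A c" "T \<subseteq> S"
  shows "T \<in> pile_complex A c"
proof -
  have "(\<Sum>a\<in>T. a $ j) \<le> (\<Sum>a\<in>S. a $ j)" for j
    by (rule sum_mono2)
      (use assms in \<open>auto simp: pile_complex_def less_eq_vec_def intro: finite_subset\<close>)
  then have "(\<Sum>a\<in>T. a) \<le> (\<Sum>a\<in>S. a)"
    by (simp add: less_eq_vec_def)
  then show ?thesis
    using assms(3,4) by (auto simp: pile_complex_def)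
qed

lemma convex_cone_hull_finite:
  fixes S :: "'a::real_vector set"
  assumes "finite S"
  shows "convex_cone hull S = {\<Sum>s\<in>S. u s *\<^sub>R s | u. \<forall>s\<in>S. 0 \<le> u s}"
  (is "_ = ?K")
proof (rule hull_unique)
  show "S \<subseteq> ?K"
  proof
    fix x assume "x \<in> S"
    then have "x = (\<Sum>s\<in>S. (if s = x then 1 else 0) *\<^sub>R s)"
      using assms by (simp add: if_distrib[of "\<lambda>t. t *\<^sub>R _"] cong: if_cong)
    then show "x \<in> ?K" by (intro CollectI exI conjI) auto
  qed
  show "convex_cone ?K"
    unfolding convex_cone_iff
  proof (intro conjI ballI allI impI)
    show "0 \<in> ?K" by (intro CollectI exI[of _ "\<lambda>_. 0"]) auto
  next
    fix x y assume "x \<in> ?K" "y \<in> ?K"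
    then obtain u v where "x = (\<Sum>s\<in>S. u s *\<^sub>R s)" "\<forall>s\<in>S. 0 \<le> u s"
      "y = (\<Sum>s\<in>S. v s *\<^sub>R s)" "\<forall>s\<in>S. 0 \<le> v s" by blast
    then show "x + y \<in> ?K"
      by (intro CollectI exI[of _ "\<lambda>s. u s + v s"]) (auto simp: sum.distrib scaleR_left_distrib)
  next
    fix x and t :: real assume "x \<in> ?K" "0 \<le> t"
    then obtain u where "x = (\<Sum>s\<in>S. u s *\<^sub>R s)" "\<forall>s\<in>S. 0 \<le> u s" by blast
    then show "t *\<^sub>R x \<in> ?K"
      using \<open>0 \<le> t\<close> by (intro CollectI exI[of _ "\<lambda>s. t * u s"]) (auto simp: scaleR_sum_right)
  qed
next
  fix T assume "S \<subseteq> T" and T: "convex_cone T"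
  have "(\<Sum>s\<in>U. u s *\<^sub>R s) \<in> T" if "finite U" "U \<subseteq> S" "\<forall>s\<in>S. 0 \<le> u s" for u U
    using that
  proof (induction U)
    case empty
    then show ?case using T by (simp add: convex_cone_contains_0)
  next
    case (insert s U)
    then show ?case using T \<open>S \<subseteq> T\<close> by (auto simp: convex_cone_iff)
  qed
  then show "?K \<subseteq> T" using assms by auto
qed

end

theory Submission
  imports Defs "HOL-Library.Function_Algebras"
begin

text \<open>For a set \<open>J\<close> of coordinates, let \<open>F J\<close> be the family of all \<open>S \<subseteq> A\<close> whose sum exceeds \<open>c\<close>
  strictly in the coordinates in \<open>J\<close> and is at most \<open>c\<close> in the others. Then \<open>F {}\<close> is the pile complex
  of \<open>c\<close>, and the complements of the members of \<open>F UNIV\<close> are the faces of the dual pile complex.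
  Chains supported on such a family form a complex under the truncated boundary operator. By the
  cone hypothesis some \<open>a \<in> A\<close> lies on the \<open>j\<close>-th axis, so \<open>Q = F J \<union> F (insert j J)\<close>, which imposes
  no condition on coordinate \<open>j\<close>, is stable under adding and removing \<open>a\<close>, and coning with \<open>a\<close>
  contracts its complex. Since \<open>F J\<close> is a subcomplex of \<open>Q\<close> whose quotient complex is that of
  \<open>F (insert j J)\<close>, the connecting isomorphism identifies their homology with a shift of degree by
  one. After \<open>n + 1\<close> such steps, pairing chains on complementary faces (Alexander duality) gives the
  result.\<close>

section \<open>Linear algebra of function spaces\<close>

text \<open>Chains are functions with pointwise addition. Naming the scalar action as a term allows
  the locale \<open>vector_space\<close> to be interpreted over an arbitrary field.\<close>

definition fun_scale :: "'k::field \<Rightarrow> ('a \<Rightarrow> 'k) \<Rightarrow> 'a \<Rightarrow> 'k" where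
  "fun_scale c f = (\<lambda>x. c * f x)"

interpretation fun_space: vector_space "fun_scale :: 'k::field \<Rightarrow> ('a \<Rightarrow> 'k) \<Rightarrow> 'a \<Rightarrow> 'k"
  by unfold_locales (auto simp: fun_scale_def fun_eq_iff algebra_simps)

interpretation fun_maps: vector_space_pair "fun_scale :: 'k::field \<Rightarrow> ('a \<Rightarrow> 'k) \<Rightarrow> 'a \<Rightarrow> 'k"
  "fun_scale :: 'k::field \<Rightarrow> ('b \<Rightarrow> 'k) \<Rightarrow> 'b \<Rightarrow> 'k" ..

interpretation functionals: vector_space_pair "fun_scale :: 'k::field \<Rightarrow> ('a \<Rightarrow> 'k) \<Rightarrow> 'a \<Rightarrow> 'k"
  "(*) :: 'k \<Rightarrow> 'k \<Rightarrow> 'k" ..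

abbreviation linear_fun :: "(('a \<Rightarrow> 'k::field) \<Rightarrow> ('b \<Rightarrow> 'k)) \<Rightarrow> bool" where
  "linear_fun \<equiv> Vector_Spaces.linear fun_scale fun_scale"

abbreviation functional :: "(('a \<Rightarrow> 'k::field) \<Rightarrow> 'k) \<Rightarrow> bool" where
  "functional \<equiv> Vector_Spaces.linear fun_scale (*)"

lemma linear_funI:
  assumes "\<And>f g x. \<phi> (f + g) x = \<phi> f x + \<phi> g x" "\<And>c f x. \<phi> (fun_scale c f) x = c * \<phi> f x"
  shows "linear_fun \<phi>"
proof -
  have "\<phi> (f + g) = \<phi> f + \<phi> g" "\<phi> (fun_scale c f) = fun_scale c (\<phi> f)" for f g c
    using assms by (simp_all add: fun_eq_iff fun_scale_def[of c "\<phi> f"])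
  then show ?thesis
    unfolding Vector_Spaces.linear_iff by (intro conjI allI fun_space.vector_space_axioms)
qed

lemma functionalI:
  assumes "\<And>f g. \<phi> (f + g) = \<phi> f + \<phi> g" "\<And>c f. \<phi> (fun_scale c f) = c * \<phi> f"
  shows "functional \<phi>"
  unfolding Vector_Spaces.linear_iff
  using assms fun_space.vector_space_axioms vector_space_over_itself.vector_space_axioms by blast

text \<open>A basis of \<open>W\<close> stays independent in the whole space, so its prescribed
  values extend to a functional there. This turns data given only on a subspace into the total
  functionals used below.\<close>

lemma functional_extension:
  fixes l :: "('a \<Rightarrow> 'k::field) \<Rightarrow> 'k"
  assumes W: "fun_space.subspace W"
    and add: "\<And>f g. f \<in> W \<Longrightarrow> g \<in> W \<Longrightarrow> l (f + g) = l f + l g"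
    and scale: "\<And>c f. f \<in> W \<Longrightarrow> l (fun_scale c f) = c * l f"
  obtains L where "functional L" "\<And>f. f \<in> W \<Longrightarrow> L f = l f"
proof -
  obtain B where B: "B \<subseteq> W" "fun_space.independent B" "W \<subseteq> fun_space.span B"
    using fun_space.maximal_independent_subset by blast
  obtain L where L: "functional L" "\<forall>x\<in>B. L x = l x"
    using functionals.linear_independent_extend[OF B(2)] by blast
  \<comment> \<open>Membership in \<open>W\<close> is carried through the induction because
    \<open>l\<close> is additive and homogeneous only there.\<close>
  have "f \<in> W \<and> L f = l f" if "f \<in> fun_space.span B" for f
    using that
  proof (induction rule: fun_space.span_induct_alt)
    case base
    then show ?case
      using scale[of 0 0] fun_space.subspace_0[OF W] functionals.linear_0[OF L(1)] by (simp add: zero_fun_def)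
  next
    case (step c x y)
    then have x: "x \<in> W" "fun_scale c x \<in> W" using B W by (auto intro: fun_space.subspace_scale)
    then show ?case
      using step L add[OF x(2), of y] scale[OF x(1), of c] W
      by (simp add: functionals.linear_add[OF L(1)] functionals.linear_scale[OF L(1)]
          fun_space.subspace_add del: plus_fun_apply)
  qed
  with that L B show thesis by blast
qed

text \<open>A function supported in a finite set is a combination of indicator functions of points,
  so \<open>L\<close> is determined by its values on these.\<close>

lemma functional_eq_sum:
  fixes L :: "('a \<Rightarrow> 'k::field) \<Rightarrow> 'k"
  assumes "functional L" "finite F" "\<And>x. x \<notin> F \<Longrightarrow> f x = 0"
  shows "L f = (\<Sum>x\<in>F. f x * L (\<lambda>y. if y = x then 1 else 0))"
proof -
  have "f = (\<Sum>x\<in>F. fun_scale (f x) (\<lambda>y. if y = x then 1 else 0))"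
  proof
    fix y
    have "(\<Sum>x\<in>F. fun_scale (f x) (\<lambda>y. if y = x then 1 else 0)) y
        = (\<Sum>x\<in>F. fun_scale (f x) (\<lambda>y. if y = x then 1 else 0) y)"
      using \<open>finite F\<close> by (induction F) auto
    also have "\<dots> = f y"
      using assms(2,3) by (auto simp: fun_scale_def if_distrib[of "\<lambda>t. _ * t"] cong: if_cong)
    finally show "f y = (\<Sum>x\<in>F. fun_scale (f x) (\<lambda>y. if y = x then 1 else 0)) y" by simp
  qed
  then have "L f = L (\<Sum>x\<in>F. fun_scale (f x) (\<lambda>y. if y = x then 1 else 0))" by simp
  also have "\<dots> = (\<Sum>x\<in>F. f x * L (\<lambda>y. if y = x then 1 else 0))"
    using assms(1) by (simp add: functionals.linear_sum functionals.linear_scale)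
  finally show ?thesis .
qed

section \<open>Homology as a quotient of function spaces\<close>

definition coset :: "('a \<Rightarrow> 'k::field) set \<Rightarrow> ('a \<Rightarrow> 'k) \<Rightarrow> ('a \<Rightarrow> 'k) set" where
  "coset B x = (\<lambda>b. b + x) ` B"

lemma mem_coset: "y \<in> coset B x \<longleftrightarrow> y - x \<in> B"
  unfolding coset_def by (metis (no_types, lifting) add_diff_cancel_right' diff_add_cancel image_iff)

lemma coset_self: "fun_space.subspace B \<Longrightarrow> x \<in> coset B x"
  by (simp add: mem_coset fun_space.subspace_0)

lemma coset_eqI:
  assumes "fun_space.subspace B" "x - y \<in> B"
  shows "coset B x = coset B y"
proof -
  have "z - x \<in> B \<longleftrightarrow> z - y \<in> B" for z
    using fun_space.subspace_add[OF assms(1) _ assms(2), of "z - x"]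
      fun_space.subspace_diff[OF assms(1) _ assms(2), of "z - y"] by auto
  then show ?thesis by (auto simp: mem_coset)
qed

text \<open>The nested union is the shape to which the sum in the quotient record unfolds. A given
  \<open>u\<close> on the right is split as \<open>(u - x') + x'\<close>.\<close>

lemma coset_add:
  assumes "fun_space.subspace B"
  shows "(\<Union>y\<in>coset B x. \<Union>z\<in>coset B x'. {y + z}) = coset B (x + x')" (is "?L = _")
proof (intro subset_antisym subsetI)
  fix u assume "u \<in> ?L"
  then obtain y z where u: "u = y + z" "y - x \<in> B" "z - x' \<in> B" by (auto simp: mem_coset)
  then have "u - (x + x') = (y - x) + (z - x')" by simp
  then show "u \<in> coset B (x + x')"
    using u fun_space.subspace_add[OF assms] by (auto simp only: mem_coset)
next
  fix u assume "u \<in> coset B (x + x')"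
  then have "u = (u - x') + x' \<and> u - x' \<in> coset B x \<and> x' \<in> coset B x'"
    using coset_self[OF assms] by (simp add: mem_coset algebra_simps)
  then show "u \<in> ?L" by blast
qed

lemma coset_scale:
  assumes "fun_space.subspace B"
  shows "(\<Union>y\<in>coset B x. coset B (fun_scale c y)) = coset B (fun_scale c x)"
proof -
  have "coset B (fun_scale c y) = coset B (fun_scale c x)" if "y \<in> coset B x" for y
    using that assms
    by (intro coset_eqI) (auto simp: mem_coset fun_space.subspace_scale fun_space.scale_right_diff_distrib[symmetric])
  then show ?thesis using coset_self[OF assms, of x] by blast
qed

section \<open>Homology records expressed through cosets\<close>

lemma cycle_module_simps:
  "carrier (cycle_module r \<Delta> i) = simplicial_cycles r \<Delta> i"
  "x \<oplus>\<^bsub>cycle_module r \<Delta> i\<^esub> y = x + y"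
  "c \<odot>\<^bsub>cycle_module r \<Delta> i\<^esub> x = fun_scale c x"
  by (simp_all add: cycle_module_def plus_fun_def fun_scale_def)

lemma a_r_coset_cycle_module: "B +>\<^bsub>cycle_module r \<Delta> i\<^esub> x = coset B x"
  by (auto simp: a_r_coset_def' cycle_module_simps coset_def)

lemma carrier_reduced_homology:
  "carrier (reduced_homology r \<Delta> i) =
     coset (simplicial_boundaries r \<Delta> i) ` simplicial_cycles r \<Delta> i"
  by (auto simp: reduced_homology_def quotient_module_def A_RCOSETS_def' a_r_coset_cycle_module
      cycle_module_simps)

lemma reduced_homology_add:
  fixes x y :: "'v set \<Rightarrow> 'k::field"
  assumes "fun_space.subspace (simplicial_boundaries r \<Delta> i :: ('v set \<Rightarrow> 'k) set)"
  shows "coset (simplicial_boundaries r \<Delta> i) x \<oplus>\<^bsub>reduced_homology r \<Delta> i\<^esub> coset (simplicial_boundaries r \<Delta> i) y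
    = coset (simplicial_boundaries r \<Delta> i) (x + y)"
  by (simp add: reduced_homology_def quotient_module_def set_add_def' cycle_module_simps coset_add[OF assms])

lemma reduced_homology_scale:
  fixes x :: "'v set \<Rightarrow> 'k::field"
  assumes "fun_space.subspace (simplicial_boundaries r \<Delta> i :: ('v set \<Rightarrow> 'k) set)"
  shows "c \<odot>\<^bsub>reduced_homology r \<Delta> i\<^esub> coset (simplicial_boundaries r \<Delta> i) x
    = coset (simplicial_boundaries r \<Delta> i) (fun_scale c x)"
  by (simp add: reduced_homology_def quotient_module_def a_r_coset_cycle_module cycle_module_simps
      coset_scale[OF assms])

text \<open>A bilinear form on cycles descends to homology and identifies one side with the dual of
  the other. \<open>radl\<close> gives both independence of the representative of the first argument
  and injectivity; \<open>radr\<close> gives independence of the second; \<open>surj\<close> makes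
  every functional a value.\<close>

lemma module_isomorphic_dual_homologyI:
  fixes \<beta> :: "('v set \<Rightarrow> 'k::field) \<Rightarrow> ('v set \<Rightarrow> 'k) \<Rightarrow> 'k"
    and r :: "'v rel" and \<Delta> \<Delta>' :: "'v set set" and i j :: int
  defines "Z \<equiv> simplicial_cycles r \<Delta> i" and "B \<equiv> simplicial_boundaries r \<Delta> i"
    and "Z' \<equiv> simplicial_cycles r \<Delta>' j" and "B' \<equiv> simplicial_boundaries r \<Delta>' j"
  assumes B: "fun_space.subspace B" and B': "fun_space.subspace B'"
    and Z: "fun_space.subspace Z" and Z': "fun_space.subspace Z'" and "B \<subseteq> Z" "B' \<subseteq> Z'"
    and linl: "\<And>w. functional (\<lambda>z. \<beta> z w)" and linr: "\<And>z. functional (\<beta> z)"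
    and radr: "\<And>z w. z \<in> Z \<Longrightarrow> w \<in> B' \<Longrightarrow> \<beta> z w = 0"
    and radl: "\<And>z. z \<in> Z \<Longrightarrow> (\<forall>w\<in>Z'. \<beta> z w = 0) \<longleftrightarrow> z \<in> B"
    and surj: "\<And>L. functional L \<Longrightarrow> (\<And>w. w \<in> B' \<Longrightarrow> L w = 0) \<Longrightarrow> \<exists>z\<in>Z. \<forall>w\<in>Z'. \<beta> z w = L w"
  shows "module_isomorphic (ring_of_type_algebra :: 'k ring)
     (reduced_homology r \<Delta> i) (dual_module (ring_of_type_algebra :: 'k ring) (reduced_homology r \<Delta>' j))"
proof -
  let ?R = "ring_of_type_algebra :: 'k ring"
  let ?M = "reduced_homology r \<Delta> i :: ('k, ('v set \<Rightarrow> 'k) set) module"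
  let ?N = "reduced_homology r \<Delta>' j :: ('k, ('v set \<Rightarrow> 'k) set) module"
  have M: "carrier ?M = coset B ` Z" and N: "carrier ?N = coset B' ` Z'"
    by (simp_all add: carrier_reduced_homology Z_def Z'_def B_def B'_def)
  note Madd = reduced_homology_add[OF B[unfolded B_def], folded B_def]
    and Nadd = reduced_homology_add[OF B'[unfolded B'_def], folded B'_def]
    and Mscale = reduced_homology_scale[OF B[unfolded B_def], folded B_def]
    and Nscale = reduced_homology_scale[OF B'[unfolded B'_def], folded B'_def]
  define rep where "rep C = (SOME x. x \<in> C)" for C :: "('v set \<Rightarrow> 'k) set"
  have rep: "rep (coset S x) - x \<in> S" if "fun_space.subspace S" for S x
    using someI[of "\<lambda>y. y \<in> coset S x", OF coset_self[OF that]] by (simp add: rep_def mem_coset)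
  \<comment> \<open>The restriction to the carrier meets the normalisation of functionals in
    \<open>dual_module\<close>.\<close>
  define F where "F C = (\<lambda>D\<in>carrier ?N. \<beta> (rep C) (rep D))" for C
  have F: "F (coset B z) (coset B' w) = \<beta> z w" if "z \<in> Z" "w \<in> Z'" for z w
  proof -
    have dz: "rep (coset B z) - z \<in> B" and dw: "rep (coset B' w) - w \<in> B'"
      using rep B B' by blast+
    then have "(rep (coset B z) - z) + z \<in> Z" "(rep (coset B' w) - w) + w \<in> Z'"
      using that Z Z' \<open>B \<subseteq> Z\<close> \<open>B' \<subseteq> Z'\<close> fun_space.subspace_add by blast+
    then have rz: "rep (coset B z) \<in> Z" and rw: "rep (coset B' w) \<in> Z'" by simp_all
    \<comment> \<open>The change of representatives is split by bilinearity into one change per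
      argument: the first term vanishes by \<open>radl\<close>, the second by
      \<open>radr\<close>.\<close>
    have "\<beta> (rep (coset B z)) (rep (coset B' w)) - \<beta> z w
        = \<beta> (rep (coset B z) - z) (rep (coset B' w)) + \<beta> z (rep (coset B' w) - w)"
      by (simp only: functionals.linear_diff[OF linl] functionals.linear_diff[OF linr]) simp
    also have "\<dots> = 0"
      using radl[of "rep (coset B z) - z"] radr[OF that(1) dw] dz rw \<open>B \<subseteq> Z\<close> by auto
    finally show ?thesis using that by (simp add: F_def N)
  qed
  have Fext: "F C = (\<lambda>D\<in>carrier ?N. F C D)" for C
    by (auto simp: F_def intro!: restrict_ext)
  have Fclosed: "F (coset B z) \<in> carrier (dual_module ?R ?N)" if "z \<in> Z" for z
    using that Z'
    by (auto simp: dual_module_def linear_maps_def self_module_def N Nadd Nscale F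
        ring_of_type_algebra_def fun_space.subspace_add fun_space.subspace_scale
        functionals.linear_add[OF linr] functionals.linear_scale[OF linr] simp del: plus_fun_apply)
      (simp add: F_def N)
  have "F \<in> linear_maps ?R ?M (dual_module ?R ?N)"
    unfolding linear_maps_def
  proof (intro CollectI conjI ballI Pi_I)
    fix C assume "C \<in> carrier ?M"
    then show "F C \<in> carrier (dual_module ?R ?N)" using Fclosed by (auto simp: M)
  next
    fix C D assume "C \<in> carrier ?M" "D \<in> carrier ?M"
    then obtain x y where xy: "x \<in> Z" "C = coset B x" "y \<in> Z" "D = coset B y" by (auto simp: M)
    have "F (C \<oplus>\<^bsub>?M\<^esub> D) E = F C E + F D E" if "E \<in> carrier ?N" for E
      using that xy Z by (auto simp: Madd F N fun_space.subspace_add functionals.linear_add[OF linl]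
          simp del: plus_fun_apply)
    then show "F (C \<oplus>\<^bsub>?M\<^esub> D) = F C \<oplus>\<^bsub>dual_module ?R ?N\<^esub> F D"
      by (subst Fext) (auto simp: dual_module_def ring_of_type_algebra_def intro!: restrict_ext)
  next
    fix c C assume "C \<in> carrier ?M"
    then obtain x where x: "x \<in> Z" "C = coset B x" by (auto simp: M)
    have "F (c \<odot>\<^bsub>?M\<^esub> C) E = c * F C E" if "E \<in> carrier ?N" for E
      using that x Z by (auto simp: Mscale F N fun_space.subspace_scale functionals.linear_scale[OF linl])
    then show "F (c \<odot>\<^bsub>?M\<^esub> C) = c \<odot>\<^bsub>dual_module ?R ?N\<^esub> F C"
      by (subst Fext) (auto simp: dual_module_def ring_of_type_algebra_def intro!: restrict_ext)
  qed
  moreover have "inj_on F (carrier ?M)"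
  proof (rule inj_onI)
    fix C D assume "C \<in> carrier ?M" "D \<in> carrier ?M" and eq: "F C = F D"
    then obtain x y where xy: "x \<in> Z" "C = coset B x" "y \<in> Z" "D = coset B y" by (auto simp: M)
    have "\<beta> (x - y) w = 0" if "w \<in> Z'" for w
      using F[OF xy(1) that] F[OF xy(3) that] eq xy
      by (simp add: functionals.linear_diff[OF linl] del: minus_apply)
    then show "C = D"
      using radl[of "x - y"] xy Z B fun_space.subspace_diff coset_eqI by metis
  qed
  moreover have "carrier (dual_module ?R ?N) \<subseteq> F ` carrier ?M"
  proof
    fix l assume l: "l \<in> carrier (dual_module ?R ?N)"
    have ladd: "l (coset B' (x + y)) = l (coset B' x) + l (coset B' y)" if "x \<in> Z'" "y \<in> Z'" for x y
      using l that by (auto simp: dual_module_def linear_maps_def self_module_def N Nadd[symmetric]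
          ring_of_type_algebra_def simp del: plus_fun_apply)
    have lscale: "l (coset B' (fun_scale c x)) = c * l (coset B' x)" if "x \<in> Z'" for x c
      using l that by (auto simp: dual_module_def linear_maps_def self_module_def N Nscale[symmetric]
          ring_of_type_algebra_def)
    \<comment> \<open>The functional on classes is pulled back to \<open>Z'\<close> and then
      extended to all functions, as \<open>surj\<close> requires.\<close>
    obtain L where L: "functional L" "\<And>w. w \<in> Z' \<Longrightarrow> L w = l (coset B' w)"
      using functional_extension[of Z' "\<lambda>w. l (coset B' w)"] Z' ladd lscale by blast
    have "L w = 0" if "w \<in> B'" for w
    proof -
      have "coset B' w = coset B' 0" using that B' by (intro coset_eqI) auto
      then have "L w = L 0"
        using L(2) that \<open>B' \<subseteq> Z'\<close> fun_space.subspace_0[OF Z'] by auto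
      then show ?thesis using functionals.linear_0[OF L(1)] by simp
    qed
    then obtain z where z: "z \<in> Z" "\<forall>w\<in>Z'. \<beta> z w = L w" using surj[OF L(1)] by blast
    have "l = F (coset B z)"
    proof (rule extensionalityI)
      show "l \<in> extensional (carrier ?N)" "F (coset B z) \<in> extensional (carrier ?N)"
        using l by (auto simp: dual_module_def F_def)
    qed (use z L F in \<open>auto simp: N\<close>)
    then show "l \<in> F ` carrier ?M" using z by (auto simp: M)
  qed
  ultimately show ?thesis
    unfolding module_isomorphic_def bij_betw_def linear_maps_def by blast
qed

section \<open>Relative chain complexes of families of faces\<close>

definition restrict_to :: "'a set \<Rightarrow> ('a \<Rightarrow> 'k::field) \<Rightarrow> 'a \<Rightarrow> 'k" where
  "restrict_to P f = (\<lambda>x. if x \<in> P then f x else 0)"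

lemma linear_restrict_to: "linear_fun (restrict_to P)"
  by (rule linear_funI) (auto simp: restrict_to_def fun_scale_def)

text \<open>This says that some linear map of the ambient spaces induces an isomorphism from
  \<open>Z / B\<close> to \<open>Z' / B'\<close>, without forming quotients. The equivalence covers
  well-definedness and injectivity, the last clause surjectivity.\<close>

definition subquotient_iso ::
    "('a \<Rightarrow> 'k::field) set \<Rightarrow> ('a \<Rightarrow> 'k) set \<Rightarrow> ('b \<Rightarrow> 'k) set \<Rightarrow> ('b \<Rightarrow> 'k) set \<Rightarrow> bool" where
  "subquotient_iso Z B Z' B' \<longleftrightarrow> (\<exists>\<phi>. linear_fun \<phi> \<and> \<phi> ` Z \<subseteq> Z' \<and>
     (\<forall>z\<in>Z. \<phi> z \<in> B' \<longleftrightarrow> z \<in> B) \<and> (\<forall>z'\<in>Z'. \<exists>z\<in>Z. z' - \<phi> z \<in> B'))"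

lemma subquotient_iso_refl:
  assumes "fun_space.subspace B"
  shows "subquotient_iso Z B Z B"
  unfolding subquotient_iso_def
  using fun_space.linear_id fun_space.subspace_0[OF assms]
  by (intro exI[of _ id]) (force simp: zero_fun_def)

text \<open>The composite map works. For surjectivity, the error
  \<open>z'' - \<psi> (\<phi> z)\<close> is the sum of \<open>z'' - \<psi> z'\<close> and
  \<open>\<psi> (z' - \<phi> z)\<close>, and \<psi> sends elements of \<open>B'\<close> into
  \<open>B''\<close>.\<close>

lemma subquotient_iso_trans:
  assumes "subquotient_iso Z B Z' B'" "subquotient_iso Z' B' Z'' B''"
    and B'': "fun_space.subspace B''" and "B' \<subseteq> Z'"
  shows "subquotient_iso Z B Z'' B''"
proof -
  from assms(1) obtain \<phi> where \<phi>: "linear_fun \<phi>" "\<phi> ` Z \<subseteq> Z'"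
    "\<forall>z\<in>Z. \<phi> z \<in> B' \<longleftrightarrow> z \<in> B" "\<forall>z'\<in>Z'. \<exists>z\<in>Z. z' - \<phi> z \<in> B'"
    unfolding subquotient_iso_def by blast
  from assms(2) obtain \<psi> where \<psi>: "linear_fun \<psi>" "\<psi> ` Z' \<subseteq> Z''"
    "\<forall>z\<in>Z'. \<psi> z \<in> B'' \<longleftrightarrow> z \<in> B'" "\<forall>z'\<in>Z''. \<exists>z\<in>Z'. z' - \<psi> z \<in> B''"
    unfolding subquotient_iso_def by blast
  have "\<exists>z\<in>Z. z'' - \<psi> (\<phi> z) \<in> B''" if z'': "z'' \<in> Z''" for z''
  proof -
    obtain z' where z': "z' \<in> Z'" "z'' - \<psi> z' \<in> B''" using \<psi>(4) z'' by blast
    obtain z where z: "z \<in> Z" "z' - \<phi> z \<in> B'" using \<phi>(4) z'(1) by blast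
    have "\<psi> (z' - \<phi> z) \<in> B''" using \<psi>(3) z(2) \<open>B' \<subseteq> Z'\<close> by (simp add: subset_iff)
    then have "(z'' - \<psi> z') + (\<psi> z' - \<psi> (\<phi> z)) \<in> B''"
      unfolding fun_maps.linear_diff[OF \<psi>(1)] by (intro fun_space.subspace_add[OF B''] z')
    then show ?thesis using z(1) by auto
  qed
  moreover have "linear_fun (\<psi> \<circ> \<phi>)" by (rule Vector_Spaces.linear_compose[OF \<phi>(1) \<psi>(1)])
  ultimately show ?thesis
    unfolding subquotient_iso_def using \<phi>(2,3) \<psi>(2,3)
    by (intro exI[of _ "\<psi> \<circ> \<phi>"]) (auto simp: image_subset_iff)
qed

section \<open>Signs, the boundary operator and cones on a finite vertex set\<close>

locale ordered_vertices =
  fixes A :: "'v set" and r :: "'v rel"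
  assumes finite_vertices: "finite A" and linear_order: "linear_order_on A r"
begin

text \<open>Excluding \<open>u = v\<close> makes the sign insensitive to whether \<open>v\<close>
  belongs to the face, so it serves both for removing and for adding \<open>v\<close>.\<close>

definition sg :: "'v \<Rightarrow> 'v set \<Rightarrow> 'k::field" where
  "sg v \<tau> = (- 1) ^ card {u \<in> \<tau>. u \<noteq> v \<and> (u, v) \<in> r}"

text \<open>The boundary operator read off coefficientwise: each \<tau> collects from the faces
  having one more vertex. In this form it is linear on all functions, with no condition on
  supports.\<close>

definition bd :: "('v set \<Rightarrow> 'k::field) \<Rightarrow> 'v set \<Rightarrow> 'k" where
  "bd f = (\<lambda>\<tau>. \<Sum>v\<in>A - \<tau>. sg v \<tau> * f (insert v \<tau>))"

text \<open>The join with the vertex \<open>a\<close>; a face already containing \<open>a\<close>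
  contributes nothing.\<close>

definition cone :: "'v \<Rightarrow> ('v set \<Rightarrow> 'k::field) \<Rightarrow> 'v set \<Rightarrow> 'k" where
  "cone a f = (\<lambda>\<tau>. if a \<in> \<tau> then sg a \<tau> * f (\<tau> - {a}) else 0)"

lemma sg_insert_same [simp]: "sg v (insert v \<tau>) = sg v \<tau>"
  and sg_remove_same [simp]: "sg v (\<tau> - {v}) = sg v \<tau>"
  unfolding sg_def by (metis (lifting) insert_iff, metis (lifting) Diff_iff singletonD)

lemma sg_square [simp]: "sg v \<tau> * (sg v \<tau> * x) = x"
  by (simp add: sg_def flip: mult.assoc power_add)

lemma sg_insert:
  assumes "u \<noteq> v" "v \<notin> \<tau>" "\<tau> \<subseteq> A"
  shows "sg u (insert v \<tau>) = (if (v, u) \<in> r then - sg u \<tau> else sg u \<tau>)"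
proof -
  have "{w \<in> insert v \<tau>. w \<noteq> u \<and> (w, u) \<in> r} =
      (if (v, u) \<in> r then insert v {w \<in> \<tau>. w \<noteq> u \<and> (w, u) \<in> r} else {w \<in> \<tau>. w \<noteq> u \<and> (w, u) \<in> r})"
    using assms by auto
  then show ?thesis
    using assms finite_subset[OF assms(3) finite_vertices] by (simp add: sg_def)
qed

text \<open>Exactly one of \<open>u\<close> and \<open>v\<close> precedes the other, so exactly one
  of the two signs changes when the other vertex is inserted. This is the cancellation behind the
  cone formula.\<close>

lemma sg_anticommute:
  assumes "u \<in> A" "v \<in> A" "u \<noteq> v" "u \<notin> \<tau>" "v \<notin> \<tau>" "\<tau> \<subseteq> A"
  shows "sg v \<tau> * sg u (insert v \<tau>) = - (sg u \<tau> * sg v (insert u \<tau>))"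
proof -
  have "(v, u) \<in> r \<longleftrightarrow> (u, v) \<notin> r"
    using linear_order assms
    by (auto simp: linear_order_on_def partial_order_on_def antisym_def total_on_def)
  then show ?thesis
    using assms by (simp add: sg_insert)
qed

lemma linear_bd: "linear_fun bd"
  by (rule linear_funI) (auto simp: bd_def fun_scale_def sum.distrib sum_distrib_left algebra_simps)

lemma linear_cone: "linear_fun (cone a)"
  by (rule linear_funI) (auto simp: cone_def fun_scale_def algebra_simps)

lemma chains_iff:
  assumes "P \<subseteq> Pow A"
  shows "f \<in> simplicial_chains P i \<longleftrightarrow> (\<forall>\<sigma>. f \<sigma> \<noteq> 0 \<longrightarrow> \<sigma> \<in> P \<and> int (card \<sigma>) = i + 1)"
proof -
  have "finite {\<sigma>. f \<sigma> \<noteq> 0}" if "\<forall>\<sigma>. f \<sigma> \<noteq> 0 \<longrightarrow> \<sigma> \<in> P"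
    by (rule finite_subset[of _ "Pow A"]) (use that assms finite_vertices in auto)
  then show ?thesis
    using assms finite_subset[OF _ finite_vertices] by (auto simp: simplicial_chains_def)
qed

lemma subspace_chains: "fun_space.subspace (simplicial_chains P i)"
  using chains_add chains_smult zero_chain(1)
  by (auto simp: fun_space.subspace_def plus_fun_def zero_fun_def fun_scale_def)

lemma restrict_to_chains:
  assumes "f \<in> simplicial_chains (Pow A) i" "P \<subseteq> Pow A"
  shows "restrict_to P f \<in> simplicial_chains P i"
  using assms by (auto simp: chains_iff restrict_to_def split: if_splits)

lemma chains_mono:
  assumes "f \<in> simplicial_chains P i" "P \<subseteq> P'"
  shows "f \<in> simplicial_chains P' i"
  using assms by (auto simp: simplicial_chains_def)

lemma restrict_to_chain:
  assumes "f \<in> simplicial_chains P i" "P \<subseteq> P'"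
  shows "restrict_to P' f = f"
  using assms by (auto simp: simplicial_chains_def restrict_to_def fun_eq_iff)

lemma bd_chains:
  assumes "f \<in> simplicial_chains (Pow A) (i + 1)"
  shows "bd f \<in> simplicial_chains (Pow A) i"
  unfolding chains_iff[OF order_refl]
proof (intro allI impI)
  fix \<tau> assume "bd f \<tau> \<noteq> 0"
  then obtain v where v: "v \<in> A - \<tau>" "f (insert v \<tau>) \<noteq> 0"
    unfolding bd_def by (metis (no_types, lifting) mult_zero_right sum.neutral)
  then have "insert v \<tau> \<subseteq> A" "int (card (insert v \<tau>)) = i + 2"
    using assms by (auto simp: chains_iff)
  then show "\<tau> \<in> Pow A \<and> int (card \<tau>) = i + 1"
    using v finite_subset[OF _ finite_vertices, of \<tau>] by auto
qed

lemma cone_chains: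
  assumes "f \<in> simplicial_chains (Pow A) i" "a \<in> A"
  shows "cone a f \<in> simplicial_chains (Pow A) (i + 1)"
  unfolding chains_iff[OF order_refl]
proof (intro allI impI)
  fix \<tau> assume "cone a f \<tau> \<noteq> 0"
  then have a: "a \<in> \<tau>" and "f (\<tau> - {a}) \<noteq> 0"
    by (auto simp: cone_def split: if_splits)
  then have "\<tau> - {a} \<subseteq> A" "int (card (\<tau> - {a})) = i + 1"
    using assms by (auto simp: chains_iff)
  moreover have "\<tau> \<subseteq> A" using calculation a assms by auto
  ultimately show "\<tau> \<in> Pow A \<and> int (card \<tau>) = i + 1 + 1"
    using a finite_subset[OF _ finite_vertices, of \<tau>] card_Suc_Diff1[of \<tau> a] by auto
qed

lemma boundary_eq_bd:
  assumes "f \<in> simplicial_chains P i" "P \<subseteq> Pow A"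
  shows "boundary r f = bd f"
proof
  fix \<tau>
  have f0: "f \<sigma> = 0" if "\<sigma> \<notin> Pow A" for \<sigma>
    using assms that by (auto simp: simplicial_chains_def)
  have "boundary r f \<tau> = (\<Sum>\<sigma>\<in>Pow A. f \<sigma> * boundary_simplex r \<sigma> \<tau>)"
    by (rule boundary_eq_sum) (use finite_vertices f0 in auto)
  \<comment> \<open>The incidence "\<tau> arises from \<sigma> by removing \<open>v\<close>" is
    rewritten as "\<sigma> arises from \<tau> by adding \<open>v\<close>"; exchanging the sums then
    leaves one \<sigma> for each \<open>v\<close>.\<close>
  also have "\<dots> = (\<Sum>\<sigma>\<in>Pow A. \<Sum>v\<in>A. if \<sigma> = insert v \<tau> then if v \<notin> \<tau> then sg v \<tau> * f \<sigma> else 0 else 0)"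
  proof (rule sum.cong[OF refl])
    fix \<sigma> assume \<sigma>: "\<sigma> \<in> Pow A"
    have "f \<sigma> * boundary_simplex r \<sigma> \<tau> = (\<Sum>v\<in>\<sigma>. if \<tau> = \<sigma> - {v} then sg v \<sigma> * f \<sigma> else 0)"
      by (simp add: boundary_simplex_def sg_def sum_distrib_left if_distrib[of "\<lambda>x. _ * x"] mult.commute
          cong: if_cong)
    also have "\<dots> = (\<Sum>v\<in>A. if v \<in> \<sigma> \<and> \<tau> = \<sigma> - {v} then sg v \<sigma> * f \<sigma> else 0)"
      using \<sigma> finite_vertices by (intro sum.mono_neutral_cong_left) auto
    also have "\<dots> = (\<Sum>v\<in>A. if \<sigma> = insert v \<tau> then if v \<notin> \<tau> then sg v \<tau> * f \<sigma> else 0 else 0)"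
      by (rule sum.cong[OF refl]) (auto simp: insert_absorb)
    finally show "f \<sigma> * boundary_simplex r \<sigma> \<tau> = \<dots>" .
  qed
  also have "\<dots> = (\<Sum>v\<in>A. \<Sum>\<sigma>\<in>Pow A. if \<sigma> = insert v \<tau> then if v \<notin> \<tau> then sg v \<tau> * f \<sigma> else 0 else 0)"
    by (rule sum.swap)
  \<comment> \<open>If \<tau> is not contained in \<open>A\<close>, then
    \<open>insert v \<tau>\<close> is not in the index set, but \<open>f\<close> vanishes
    there.\<close>
  also have "\<dots> = (\<Sum>v\<in>A. if v \<notin> \<tau> then sg v \<tau> * f (insert v \<tau>) else 0)"
    using finite_vertices f0[of "insert _ \<tau>"] by (intro sum.cong[OF refl]) auto
  also have "\<dots> = bd f \<tau>"
    unfolding bd_def using finite_vertices by (intro sum.mono_neutral_cong_right) auto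
  finally show "boundary r f \<tau> = bd f \<tau>" .
qed

lemma bd_bd:
  assumes "f \<in> simplicial_chains (Pow A) i"
  shows "bd (bd f) = 0"
proof -
  have "bd f \<in> simplicial_chains (Pow A) (i - 1)" using bd_chains[of f "i - 1"] assms by simp
  then have "bd (bd f) = boundary r (boundary r f)"
    by (simp only: boundary_eq_bd[OF assms order_refl] boundary_eq_bd[OF _ order_refl])
  also have "\<dots> = 0"
    using boundary_boundary[OF linear_order _ assms] by (simp add: zero_fun_def)
  finally show ?thesis .
qed

text \<open>This is the homotopy formula for the cone. If \<open>a\<close> is not in \<tau>, only
  the term \<open>v = a\<close> survives in the first summand. If it is, the term
  \<open>v = a\<close> of the second summand yields \<open>f \<tau>\<close> and all others cancel in
  pairs by anticommutation of signs.\<close>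

lemma bd_cone:
  fixes f :: "'v set \<Rightarrow> 'k::field"
  assumes "a \<in> A" "\<tau> \<subseteq> A"
  shows "bd (cone a f) \<tau> + cone a (bd f) \<tau> = f \<tau>"
proof (cases "a \<in> \<tau>")
  case False
  have "bd (cone a f) \<tau> = (\<Sum>v\<in>A - \<tau>. if v = a then f \<tau> else 0)"
    unfolding bd_def cone_def using False by (intro sum.cong) auto
  also have "\<dots> = f \<tau>" using False assms finite_vertices by simp
  finally show ?thesis using False by (simp add: cone_def)
next
  case True
  define \<rho> where "\<rho> = \<tau> - {a}"
  have \<tau>: "\<tau> = insert a \<rho>" "a \<notin> \<rho>" "\<rho> \<subseteq> A" using True assms by (auto simp: \<rho>_def)
  have "A - \<rho> = insert a (A - \<tau>)" "a \<notin> A - \<tau>" using \<tau> assms by auto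
  then have "bd f \<rho> = sg a \<rho> * f \<tau> + (\<Sum>v\<in>A - \<tau>. sg v \<rho> * f (insert v \<rho>))"
    unfolding bd_def using finite_vertices by (simp add: \<tau>(1)[symmetric])
  then have 1: "cone a (bd f) \<tau> = f \<tau> + (\<Sum>v\<in>A - \<tau>. sg a \<rho> * (sg v \<rho> * f (insert v \<rho>)))"
    using True by (simp add: cone_def \<rho>_def distrib_left sum_distrib_left)
  have 2: "bd (cone a f) \<tau> = (\<Sum>v\<in>A - \<tau>. - (sg a \<rho> * (sg v \<rho> * f (insert v \<rho>))))"
    unfolding bd_def
  proof (rule sum.cong[OF refl])
    fix v assume v: "v \<in> A - \<tau>"
    then have va: "v \<noteq> a" "v \<notin> \<rho>" using True by (auto simp: \<rho>_def)
    then have "insert v \<tau> - {a} = insert v \<rho>" by (auto simp: \<rho>_def)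
    moreover from this have "sg a (insert v \<tau>) = (sg a (insert v \<rho>) :: 'k)"
      by (metis sg_remove_same)
    ultimately have "cone a f (insert v \<tau>) = sg a (insert v \<rho>) * f (insert v \<rho>)"
      using True by (simp add: cone_def)
    moreover have "sg v \<tau> * sg a (insert v \<rho>) = - (sg a \<rho> * sg v \<rho> :: 'k)"
    proof -
      have "sg v \<rho> * sg a (insert v \<rho>) = - (sg a \<rho> * sg v \<tau> :: 'k)"
        using sg_anticommute[of a v \<rho>] v va \<tau>(2,3) assms(1) by (simp add: \<tau>(1)[symmetric])
      \<comment> \<open>Since the two values agree up to sign, they can trade places between the two
        sides of the preceding identity.\<close>
      moreover have "sg v \<tau> = (sg v \<rho> :: 'k) \<or> sg v \<tau> = (- sg v \<rho> :: 'k)"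
        unfolding \<tau>(1) using va(1) \<tau>(2,3) by (simp add: sg_insert)
      ultimately show ?thesis by (auto simp: mult.commute)
    qed
    ultimately show "sg v \<tau> * cone a f (insert v \<tau>) = - (sg a \<rho> * (sg v \<rho> * f (insert v \<rho>)))"
      by (metis (no_types, lifting) mult.assoc mult_minus_left)
  qed
  show ?thesis
    unfolding 1 2 by (simp add: sum_negf)
qed

section \<open>Truncated boundary operators and their homology\<close>

definition rel_bd :: "'v set set \<Rightarrow> ('v set \<Rightarrow> 'k::field) \<Rightarrow> 'v set \<Rightarrow> 'k" where
  "rel_bd P f = restrict_to P (bd f)"

definition rel_cycles :: "'v set set \<Rightarrow> int \<Rightarrow> ('v set \<Rightarrow> 'k::field) set" where
  "rel_cycles P i = {f \<in> simplicial_chains P i. rel_bd P f = 0}"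

definition rel_boundaries :: "'v set set \<Rightarrow> int \<Rightarrow> ('v set \<Rightarrow> 'k::field) set" where
  "rel_boundaries P i = rel_bd P ` simplicial_chains P (i + 1)"

lemma linear_rel_bd: "linear_fun (rel_bd P :: ('v set \<Rightarrow> 'k::field) \<Rightarrow> _)"
proof -
  have "rel_bd P = restrict_to P \<circ> (bd :: ('v set \<Rightarrow> 'k) \<Rightarrow> _)" by (simp add: fun_eq_iff rel_bd_def)
  then show ?thesis
    by (simp only: Vector_Spaces.linear_compose[OF linear_bd linear_restrict_to])
qed

lemma subspace_rel_cycles: "fun_space.subspace (rel_cycles P i)"
  unfolding rel_cycles_def Collect_conj_eq Collect_mem_eq
  by (rule fun_space.subspace_inter[OF subspace_chains fun_maps.linear_subspace_kernel[OF linear_rel_bd]])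

lemma subspace_rel_boundaries: "fun_space.subspace (rel_boundaries P i)"
  unfolding rel_boundaries_def
  by (rule fun_maps.linear_subspace_image[OF linear_rel_bd subspace_chains])

lemma rel_bd_chains:
  assumes "f \<in> simplicial_chains P (i + 1)" "P \<subseteq> Pow A"
  shows "rel_bd P f \<in> simplicial_chains P i"
  unfolding rel_bd_def by (rule restrict_to_chains[OF bd_chains[OF chains_mono[OF assms]] assms(2)])

text \<open>A family convex under inclusion is the difference of a complex and a subcomplex, so the
  truncated operator is the boundary of a relative chain complex. Concretely, a face lying between
  \<tau> in \<open>P\<close> and a face in the support of \<open>f\<close> is itself in
  \<open>P\<close>, so truncating loses nothing that reaches \<tau>.\<close>

lemma rel_bd_rel_bd:
  assumes "f \<in> simplicial_chains P i" "P \<subseteq> Pow A"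
    and convex: "\<And>\<tau> \<sigma> \<rho>. \<tau> \<in> P \<Longrightarrow> \<rho> \<in> P \<Longrightarrow> \<tau> \<subseteq> \<sigma> \<Longrightarrow> \<sigma> \<subseteq> \<rho> \<Longrightarrow> \<sigma> \<in> P"
  shows "rel_bd P (rel_bd P f) = 0"
proof
  fix \<tau>
  have "bd (rel_bd P f) \<tau> = bd (bd f) \<tau>" if "\<tau> \<in> P"
  proof -
    have "restrict_to P (bd f) (insert v \<tau>) = bd f (insert v \<tau>)" for v
    proof (cases "insert v \<tau> \<in> P")
      case False
      have "f (insert u (insert v \<tau>)) = 0" for u
        using convex[OF that, of "insert u (insert v \<tau>)" "insert v \<tau>"] False assms(1)
        by (auto simp: simplicial_chains_def)
      then show ?thesis using False by (simp add: restrict_to_def bd_def)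
    qed (simp add: restrict_to_def)
    then show ?thesis by (simp add: bd_def[of "restrict_to P (bd f)"] bd_def[of "bd f"] rel_bd_def)
  qed
  then show "rel_bd P (rel_bd P f) \<tau> = 0 \<tau>"
    by (simp add: bd_bd[OF chains_mono[OF assms(1,2)]] rel_bd_def[of P "rel_bd P f"] restrict_to_def)
qed

lemma rel_boundaries_subset_cycles:
  assumes "P \<subseteq> Pow A"
    and convex: "\<And>\<tau> \<sigma> \<rho>. \<tau> \<in> P \<Longrightarrow> \<rho> \<in> P \<Longrightarrow> \<tau> \<subseteq> \<sigma> \<Longrightarrow> \<sigma> \<subseteq> \<rho> \<Longrightarrow> \<sigma> \<in> P"
  shows "rel_boundaries P i \<subseteq> rel_cycles P i"
proof
  fix g :: "'v set \<Rightarrow> 'k::field"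
  assume "g \<in> rel_boundaries P i"
  then obtain f where f: "f \<in> simplicial_chains P (i + 1)" "g = rel_bd P f"
    by (auto simp: rel_boundaries_def)
  have "rel_bd P (rel_bd P f) = 0"
    by (rule rel_bd_rel_bd[OF f(1) assms(1)]) (rule convex)
  then show "g \<in> rel_cycles P i"
    using rel_bd_chains[OF f(1) assms(1)] f(2) by (simp add: rel_cycles_def)
qed

text \<open>\<open>L\<close> carries a subcomplex of the complex of \<open>Q\<close>, with quotient
  carried by \<open>U\<close>. As coning with \<open>a\<close> contracts the complex of
  \<open>Q\<close>, the connecting map is bijective on homology; the map used here, cone followed by
  restriction to \<open>U\<close>, is its inverse.\<close>

lemma connecting_iso:
  fixes i :: int
  assumes Q: "Q \<subseteq> Pow A"
    and convex: "\<And>\<tau> \<sigma> \<rho>. \<tau> \<in> Q \<Longrightarrow> \<rho> \<in> Q \<Longrightarrow> \<tau> \<subseteq> \<sigma> \<Longrightarrow> \<sigma> \<subseteq> \<rho> \<Longrightarrow> \<sigma> \<in> Q"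
    and a: "a \<in> A" "\<And>\<sigma>. \<sigma> \<in> Q \<Longrightarrow> insert a \<sigma> \<in> Q" "\<And>\<sigma>. \<sigma> \<in> Q \<Longrightarrow> \<sigma> - {a} \<in> Q"
    and LU: "L \<union> U = Q" "L \<inter> U = {}"
    and down: "\<And>\<sigma> \<tau>. \<sigma> \<in> L \<Longrightarrow> \<tau> \<in> Q \<Longrightarrow> \<tau> \<subseteq> \<sigma> \<Longrightarrow> \<tau> \<in> L"
  shows "subquotient_iso (rel_cycles L i) (rel_boundaries L i :: ('v set \<Rightarrow> 'k::field) set)
     (rel_cycles U (i + 1)) (rel_boundaries U (i + 1) :: ('v set \<Rightarrow> 'k) set)"
proof -
  let ?C = "simplicial_chains :: _ \<Rightarrow> _ \<Rightarrow> ('v set \<Rightarrow> 'k) set"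
  \<comment> \<open>\<open>d\<close> is the boundary on \<open>Q\<close>, \<open>h\<close> the
    contracting homotopy, and \<open>p\<close> the projection onto the quotient complex.\<close>
  define d where "d = (rel_bd Q :: ('v set \<Rightarrow> 'k) \<Rightarrow> _)"
  define h where "h = (cone a :: ('v set \<Rightarrow> 'k) \<Rightarrow> _)"
  define p where "p = (restrict_to U :: ('v set \<Rightarrow> 'k) \<Rightarrow> _)"
  have lin: "linear_fun d" "linear_fun h" "linear_fun p"
    unfolding d_def h_def p_def by (rule linear_rel_bd linear_cone linear_restrict_to)+
  note diffs = lin[THEN fun_maps.linear_diff]
  have LQ: "L \<subseteq> Q" and UQ: "U \<subseteq> Q" using LU by auto
  have LA: "L \<subseteq> Pow A" and UA: "U \<subseteq> Pow A" using LQ UQ Q by auto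
  have dC: "d f \<in> ?C Q j" if "f \<in> ?C Q (j + 1)" for f j
    unfolding d_def using that Q by (rule rel_bd_chains)
  have dd: "d (d f) = 0" if "f \<in> ?C Q j" for f j
    unfolding d_def by (rule rel_bd_rel_bd[OF that Q]) (rule convex)
  have hC: "h f \<in> ?C Q (j + 1)" if "f \<in> ?C Q j" for f j
  proof -
    have "\<tau> \<in> Q" if "h f \<tau> \<noteq> 0" for \<tau>
    proof -
      have "a \<in> \<tau>" "f (\<tau> - {a}) \<noteq> 0" using that by (auto simp: h_def cone_def split: if_splits)
      moreover from this have "\<tau> - {a} \<in> Q" using \<open>f \<in> ?C Q j\<close> by (auto simp: simplicial_chains_def)
      ultimately show ?thesis using a(2)[of "\<tau> - {a}"] by (simp add: insert_absorb)
    qed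
    moreover have "h f \<in> ?C (Pow A) (j + 1)"
      unfolding h_def using cone_chains[OF chains_mono[OF that Q] a(1)] .
    ultimately show ?thesis by (simp add: simplicial_chains_def)
  qed
  have pC: "p f \<in> ?C U j" if "f \<in> ?C Q j" for f j
    unfolding p_def using chains_mono[OF that Q] UA by (rule restrict_to_chains)
  have LC: "f \<in> ?C L j" if "f \<in> ?C Q j" "p f = 0" for f j
  proof -
    have "\<sigma> \<in> L" if "f \<sigma> \<noteq> 0" for \<sigma>
    proof -
      have "p f \<sigma> = 0" using \<open>p f = 0\<close> by simp
      then have "\<sigma> \<notin> U" using that by (auto simp: p_def restrict_to_def)
      then show ?thesis using that \<open>f \<in> ?C Q j\<close> LU by (auto simp: simplicial_chains_def)
    qed
    then show ?thesis using that(1) by (simp add: simplicial_chains_def)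
  qed
  have pX: "p x = 0" if "x \<in> ?C L j" for x j
    using that LU(2) by (auto simp: p_def restrict_to_def simplicial_chains_def fun_eq_iff)
  have pY: "p y = y" if "y \<in> ?C U j" for y j
    unfolding p_def using that by (rule restrict_to_chain) simp
  \<comment> \<open>The cone formula survives truncation to \<open>Q\<close>, since for \<tau>
    containing \<open>a\<close> the faces \<tau> and \<open>\<tau> - {a}\<close> are both in
    \<open>Q\<close> or both outside.\<close>
  have homotopy: "h (d f) = f - d (h f)" if f: "f \<in> ?C Q j" for f j
  proof
    fix \<tau>
    show "h (d f) \<tau> = (f - d (h f)) \<tau>"
    proof (cases "\<tau> \<in> Q")
      case True
      then have "h (d f) \<tau> = h (bd f) \<tau>" "d (h f) \<tau> = bd (h f) \<tau>"
        using a(3)[of \<tau>] by (auto simp: h_def d_def rel_bd_def cone_def restrict_to_def)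
      then show ?thesis using bd_cone[OF a(1), of \<tau> f] True Q
        by (auto simp: h_def eq_diff_eq add.commute)
    next
      case False
      then have "a \<in> \<tau> \<Longrightarrow> \<tau> - {a} \<notin> Q" using a(2)[of "\<tau> - {a}"] by (auto simp: insert_absorb)
      then show ?thesis
        using False f by (auto simp: h_def d_def rel_bd_def cone_def restrict_to_def simplicial_chains_def)
    qed
  qed
  \<comment> \<open>A face of \<open>Q\<close> below a face of \<open>L\<close> is in
    \<open>L\<close>, so on chains of \<open>L\<close> truncating to \<open>Q\<close> or to
    \<open>L\<close> is the same.\<close>
  have dX: "rel_bd L x = d x" if "x \<in> ?C L j" for x j
  proof
    fix \<tau>
    have "bd x \<tau> = 0" if "\<tau> \<in> Q" "\<tau> \<notin> L"
    proof -
      have "x (insert v \<tau>) = 0" for v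
        using down[of "insert v \<tau>" \<tau>] that \<open>x \<in> ?C L j\<close> by (auto simp: simplicial_chains_def)
      then show ?thesis by (simp add: bd_def)
    qed
    then show "rel_bd L x \<tau> = d x \<tau>"
      using LQ by (auto simp: rel_bd_def d_def restrict_to_def)
  qed
  have pd: "rel_bd U f = p (d f)" for f
    using UQ by (auto simp: rel_bd_def d_def p_def restrict_to_def fun_eq_iff)
  have pdX: "p (d x) = 0" if "x \<in> ?C L j" for x j
    using LU by (auto simp: dX[OF that, symmetric] p_def rel_bd_def restrict_to_def fun_eq_iff)
  \<comment> \<open>\<open>p\<close> is a chain map: the discarded part \<open>f - p f\<close> is a
    chain of \<open>L\<close>, and \<open>d\<close> keeps it in \<open>L\<close>.\<close>
  have pdp: "rel_bd U (p f) = p (d f)" if f: "f \<in> ?C Q j" for f j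
  proof -
    have "f - p f \<in> ?C Q j"
      by (rule fun_space.subspace_diff[OF subspace_chains f chains_mono[OF pC[OF f] UQ]])
    moreover have "p (f - p f) = 0"
      unfolding diffs pY[OF pC[OF f]] by simp
    ultimately have "p (d (f - p f)) = 0"
      using pdX LC by blast
    then show ?thesis unfolding pd diffs by simp
  qed
  have maps: "p (h x) \<in> rel_cycles U (i + 1)" if x: "x \<in> rel_cycles L i" for x
  proof -
    have xC: "x \<in> ?C L i" "x \<in> ?C Q i" and "d x = 0"
      using x chains_mono[OF _ LQ] dX by (auto simp: rel_cycles_def)
    then have "d (h x) = x"
      using homotopy[OF xC(2)] fun_maps.linear_0[OF lin(2)] by simp
    then show ?thesis
      using pC[OF hC[OF xC(2)]] pdp[OF hC[OF xC(2)]] pX[OF xC(1)] by (simp add: rel_cycles_def)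
  qed
  have kernel: "p (h x) \<in> rel_boundaries U (i + 1) \<longleftrightarrow> x \<in> rel_boundaries L i" if x: "x \<in> rel_cycles L i" for x
  proof
    \<comment> \<open>If \<open>d y\<close> agrees with \<open>h x\<close> on \<open>U\<close>, then
      \<open>h x - d y\<close> is a chain of \<open>L\<close> whose boundary is
      \<open>x\<close>.\<close>
    assume "p (h x) \<in> rel_boundaries U (i + 1)"
    then obtain y where y: "y \<in> ?C U (i + 1 + 1)" "p (h x) = p (d y)"
      by (auto simp: rel_boundaries_def pd)
    have xC: "x \<in> ?C Q i" and "d x = 0"
      using x chains_mono[OF _ LQ] dX by (auto simp: rel_cycles_def)
    then have dh: "d (h x) = x"
      using homotopy[OF xC] fun_maps.linear_0[OF lin(2)] by simp
    have yC: "y \<in> ?C Q (i + 1 + 1)" using y(1) UQ by (rule chains_mono)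
    have w: "h x - d y \<in> ?C L (i + 1)"
    proof (rule LC)
      show "h x - d y \<in> ?C Q (i + 1)"
        by (rule fun_space.subspace_diff[OF subspace_chains hC[OF xC] dC[OF yC]])
      show "p (h x - d y) = 0" unfolding diffs y(2) by simp
    qed
    have "rel_bd L (h x - d y) = x"
      unfolding dX[OF w] diffs dh dd[OF yC] by simp
    then show "x \<in> rel_boundaries L i"
      unfolding rel_boundaries_def using w by (intro image_eqI[OF sym])
  next
    \<comment> \<open>Conversely, for \<open>x = d w\<close> the homotopy gives
      \<open>h x = w - d (h w)\<close>, and \<open>p\<close> kills \<open>w\<close>.\<close>
    assume "x \<in> rel_boundaries L i"
    then obtain w where w: "w \<in> ?C L (i + 1)" "x = d w"
      using dX by (auto simp: rel_boundaries_def)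
    have wC: "w \<in> ?C Q (i + 1)" using w(1) LQ by (rule chains_mono)
    have "p (h x) = p (w - d (h w))" unfolding w(2) homotopy[OF wC] ..
    also have "\<dots> = - rel_bd U (p (h w))"
      unfolding diffs pdp[OF hC[OF wC]] pX[OF w(1)] by simp
    finally have "p (h x) = - rel_bd U (p (h w))" .
    moreover have "rel_bd U (p (h w)) \<in> rel_boundaries U (i + 1)"
      unfolding rel_boundaries_def by (rule imageI) (rule pC[OF hC[OF wC]])
    ultimately show "p (h x) \<in> rel_boundaries U (i + 1)"
      using fun_space.subspace_neg[OF subspace_rel_boundaries] by metis
  qed
  \<comment> \<open>The preimage is \<open>d y\<close>, the connecting map applied to
    \<open>y\<close>; by the homotopy the error is the projection of \<open>d (h y)\<close>.\<close>
  have surj: "\<exists>x\<in>rel_cycles L i. y - p (h x) \<in> rel_boundaries U (i + 1)" if y: "y \<in> rel_cycles U (i + 1)" for y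
  proof (rule bexI)
    have yC: "y \<in> ?C U (i + 1)" "y \<in> ?C Q (i + 1)" "p (d y) = 0"
      using y chains_mono[OF _ UQ] by (auto simp: rel_cycles_def pd)
    have "d y \<in> ?C L i" using dC[OF yC(2)] yC(3) by (rule LC)
    then show "d y \<in> rel_cycles L i"
      using dd[OF yC(2)] by (simp add: rel_cycles_def dX)
    have "y - p (h (d y)) = rel_bd U (p (h y))"
      unfolding homotopy[OF yC(2)] diffs pY[OF yC(1)] pdp[OF hC[OF yC(2)]] by simp
    moreover have "rel_bd U (p (h y)) \<in> rel_boundaries U (i + 1)"
      unfolding rel_boundaries_def by (rule imageI) (rule pC[OF hC[OF yC(2)]])
    ultimately show "y - p (h (d y)) \<in> rel_boundaries U (i + 1)" by metis
  qed
  have "linear_fun (p \<circ> h)"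
    by (rule Vector_Spaces.linear_compose[OF lin(2,3)])
  then show ?thesis
    unfolding subquotient_iso_def using maps kernel surj
    by (intro exI[of _ "p \<circ> h"]) auto
qed

section \<open>Alexander duality\<close>

text \<open>The sign makes the boundary operator self-adjoint.\<close>

definition dual_sign :: "'v set \<Rightarrow> 'k::field" where
  "dual_sign \<sigma> = (\<Prod>v\<in>\<sigma>. sg v A)"

text \<open>Each face is matched with its complement, so chains pair nontrivially only in
  complementary degrees.\<close>

definition pairing :: "('v set \<Rightarrow> 'k::field) \<Rightarrow> ('v set \<Rightarrow> 'k) \<Rightarrow> 'k" where
  "pairing z w = (\<Sum>\<sigma>\<in>Pow A. dual_sign \<sigma> * z (A - \<sigma>) * w \<sigma>)"

lemma sg_complement:
  assumes "\<tau> \<subseteq> A"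
  shows "sg v \<tau> * sg v (A - \<tau>) = (sg v A :: 'k::field)"
proof -
  have "{u \<in> A. u \<noteq> v \<and> (u, v) \<in> r} = {u \<in> \<tau>. u \<noteq> v \<and> (u, v) \<in> r} \<union> {u \<in> A - \<tau>. u \<noteq> v \<and> (u, v) \<in> r}"
    using assms by auto
  then have "card {u \<in> A. u \<noteq> v \<and> (u, v) \<in> r} =
      card {u \<in> \<tau>. u \<noteq> v \<and> (u, v) \<in> r} + card {u \<in> A - \<tau>. u \<noteq> v \<and> (u, v) \<in> r}"
    using finite_vertices finite_subset[OF assms] by (simp only:) (rule card_Un_disjoint, auto)
  then show ?thesis by (simp add: sg_def power_add)
qed

text \<open>The new factor \<open>sg v A\<close> splits into the signs of \<open>v\<close> in \<tau>
  and in its complement, and the latter squares to 1. This is the sign comparison needed to move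
  \<open>bd\<close> across the pairing.\<close>

lemma dual_sign_insert:
  assumes "\<tau> \<subseteq> A" "v \<in> A - \<tau>"
  shows "dual_sign (insert v \<tau>) * sg v (A - \<tau>) = (dual_sign \<tau> * sg v \<tau> :: 'k::field)"
proof -
  have "dual_sign (insert v \<tau>) = (sg v A * dual_sign \<tau> :: 'k)"
    using assms finite_subset[OF assms(1) finite_vertices] by (simp add: dual_sign_def)
  also have "\<dots> * sg v (A - \<tau>) = dual_sign \<tau> * sg v \<tau> * (sg v (A - \<tau>) * sg v (A - \<tau>))"
    unfolding sg_complement[OF assms(1), symmetric] by (simp only: ac_simps)
  also have "sg v (A - \<tau>) * sg v (A - \<tau>) = (1 :: 'k)"
    using sg_square[of v "A - \<tau>" "1 :: 'k"] by simp
  finally show ?thesis by (simp only: mult_1_right)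
qed

lemma dual_sign_nonzero: "dual_sign \<sigma> \<noteq> (0 :: 'k::field)"
  by (cases "finite \<sigma>") (auto simp: dual_sign_def sg_def)

text \<open>Both sides are sums over incidences of faces differing by one vertex: pairs of \<tau>
  and an added \<open>v\<close> correspond to pairs of \<sigma> and a removed
  \<open>v\<close>.\<close>

lemma pairing_bd: "pairing z (bd g) = pairing (bd z) (g :: 'v set \<Rightarrow> 'k::field)"
proof -
  have "pairing z (bd g)
      = (\<Sum>(\<tau>, v)\<in>Sigma (Pow A) (\<lambda>\<tau>. A - \<tau>). dual_sign \<tau> * sg v \<tau> * z (A - \<tau>) * g (insert v \<tau>))"
    using finite_vertices by (simp add: pairing_def bd_def sum.Sigma[symmetric] sum_distrib_left ac_simps)
  also have "\<dots> = (\<Sum>(\<sigma>, v)\<in>Sigma (Pow A) (\<lambda>\<sigma>. \<sigma>). dual_sign \<sigma> * sg v (A - \<sigma>) * z (insert v (A - \<sigma>)) * g \<sigma>)"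
  proof (rule sum.reindex_bij_witness[where i = "\<lambda>(\<sigma>, v). (\<sigma> - {v}, v)" and j = "\<lambda>(\<tau>, v). (insert v \<tau>, v)"])
    fix p assume "p \<in> Sigma (Pow A) (\<lambda>\<tau>. A - \<tau>)"
    then obtain \<tau> v where v: "\<tau> \<subseteq> A" "v \<in> A" "v \<notin> \<tau>" and p: "p = (\<tau>, v)" by auto
    have "insert v (A - insert v \<tau>) = A - \<tau>" "A - insert v \<tau> = A - \<tau> - {v}" using v by auto
    then show "(case case p of (\<tau>, v) \<Rightarrow> (insert v \<tau>, v) of (\<sigma>, v) \<Rightarrow>
          dual_sign \<sigma> * sg v (A - \<sigma>) * z (insert v (A - \<sigma>)) * g \<sigma>)
        = (case p of (\<tau>, v) \<Rightarrow> dual_sign \<tau> * sg v \<tau> * z (A - \<tau>) * g (insert v \<tau>))"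
      using dual_sign_insert[of \<tau> v, where 'k='k] v by (simp add: p)
  qed auto
  also have "\<dots> = pairing (bd z) g"
    using finite_vertices finite_subset[OF _ finite_vertices]
    by (auto simp: pairing_def bd_def sum.Sigma[symmetric] sum_distrib_left sum_distrib_right ac_simps
        double_diff intro!: sum.cong)
  finally show ?thesis .
qed

lemma functional_pairing_left: "functional (\<lambda>z. pairing z w)"
  by (rule functionalI) (auto simp: pairing_def fun_scale_def sum.distrib sum_distrib_left algebra_simps)

lemma functional_pairing_right: "functional (pairing z)"
  by (rule functionalI) (auto simp: pairing_def fun_scale_def sum.distrib sum_distrib_left algebra_simps)


lemma dual_sign_square [simp]:
  fixes x :: "'k::field"
  shows "dual_sign \<sigma> * (dual_sign \<sigma> * x) = x"
proof -
  have "dual_sign \<sigma> * dual_sign \<sigma> = (\<Prod>v\<in>\<sigma>. sg v A * (sg v A * (1 :: 'k)))"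
    by (simp add: dual_sign_def prod.distrib del: sg_square)
  then have "dual_sign \<sigma> * dual_sign \<sigma> = (1 :: 'k)"
    by (simp only: sg_square prod.neutral_const)
  then show ?thesis by (simp flip: mult.assoc)
qed

definition complements :: "'v set set \<Rightarrow> 'v set set" where
  "complements P = {\<sigma>. \<sigma> \<subseteq> A \<and> A - \<sigma> \<in> P}"

lemma complements_subset: "complements P \<subseteq> Pow A"
  by (auto simp: complements_def)

lemma card_complement:
  assumes "\<sigma> \<subseteq> A"
  shows "int (card (A - \<sigma>)) = int (card A) - int (card \<sigma>)"
  using card_Diff_subset[OF finite_subset[OF assms finite_vertices] assms] card_mono[OF finite_vertices assms]
  by simp

text \<open>The chain of degree \<open>m\<close> on \<open>P\<close> that represents
  \<open>l\<close> under the pairing: its coefficient on a face is, up to sign, the value of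
  \<open>l\<close> on the complementary face.\<close>

definition dual_chain :: "'v set set \<Rightarrow> int \<Rightarrow> (('v set \<Rightarrow> 'k::field) \<Rightarrow> 'k) \<Rightarrow> 'v set \<Rightarrow> 'k" where
  "dual_chain P m l = (\<lambda>\<tau>. if \<tau> \<in> P \<and> int (card \<tau>) = m + 1
     then dual_sign (A - \<tau>) * l (\<lambda>\<sigma>. if \<sigma> = A - \<tau> then 1 else 0) else 0)"

lemma dual_chain_chains: "P \<subseteq> Pow A \<Longrightarrow> dual_chain P m l \<in> simplicial_chains P m"
  by (auto simp: chains_iff dual_chain_def split: if_splits)

text \<open>A face of degree \<open>m\<close> has \<open>m + 1\<close> vertices, so its complement
  has degree \<open>card A - m - 2\<close>. Expanding \<open>w\<close> in single faces, the two dual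
  signs cancel.\<close>

lemma pairing_dual_chain:
  assumes l: "functional l" and w: "w \<in> simplicial_chains (complements P) (int (card A) - m - 2)"
  shows "pairing (dual_chain P m l) w = l w"
proof -
  have w0: "\<sigma> \<in> Pow A \<and> A - \<sigma> \<in> P \<and> int (card (A - \<sigma>)) = m + 1" if "w \<sigma> \<noteq> 0" for \<sigma>
    using w that card_complement[of \<sigma>] by (auto simp: complements_def simplicial_chains_def)
  have "l w = (\<Sum>\<sigma>\<in>Pow A. w \<sigma> * l (\<lambda>\<tau>. if \<tau> = \<sigma> then 1 else 0))"
    by (rule functional_eq_sum[OF l]) (use finite_vertices w0 in auto)
  also have "\<dots> = pairing (dual_chain P m l) w"
    unfolding pairing_def
  proof (rule sum.cong[OF refl])
    fix \<sigma> assume "\<sigma> \<in> Pow A"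
    then have "A - (A - \<sigma>) = \<sigma>" by auto
    then show "w \<sigma> * l (\<lambda>\<tau>. if \<tau> = \<sigma> then 1 else 0) = dual_sign \<sigma> * dual_chain P m l (A - \<sigma>) * w \<sigma>"
      using w0[of \<sigma>] by (cases "w \<sigma> = 0") (simp_all add: dual_chain_def mult.assoc mult.commute[of "w \<sigma>"])
  qed
  finally show ?thesis ..
qed

text \<open>The indicator of the complement of a face picks out the coefficient of \<open>z\<close>
  on that face, up to sign.\<close>

lemma pairing_nondegenerate:
  assumes z: "z \<in> simplicial_chains P m" and P: "P \<subseteq> Pow A"
    and 0: "\<And>w. w \<in> simplicial_chains (complements P) (int (card A) - m - 2) \<Longrightarrow> pairing z w = 0"
  shows "z = 0"
proof (rule ccontr)
  assume "z \<noteq> 0"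
  then obtain \<tau> where \<tau>: "z \<tau> \<noteq> 0" by (auto simp: fun_eq_iff)
  then have *: "\<tau> \<in> P" "\<tau> \<subseteq> A" "int (card \<tau>) = m + 1"
    using z P by (auto simp: simplicial_chains_def)
  then have [simp]: "A - (A - \<tau>) = \<tau>" by auto
  define w :: "'v set \<Rightarrow> 'a" where "w = (\<lambda>\<sigma>. if \<sigma> = A - \<tau> then 1 else 0)"
  have "w \<in> simplicial_chains (complements P) (int (card A) - m - 2)"
    unfolding chains_iff[OF complements_subset]
    using * card_complement[of \<tau>] by (auto simp: w_def complements_def)
  then have "pairing z w = 0" by (rule 0)
  moreover have "pairing z w = (\<Sum>\<sigma>\<in>Pow A. if \<sigma> = A - \<tau> then dual_sign (A - \<tau>) * z \<tau> else 0)"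
    unfolding pairing_def by (rule sum.cong) (auto simp: w_def)
  ultimately show False
    using \<tau> finite_vertices dual_sign_nonzero[of "A - \<tau>"] by auto
qed

text \<open>The truncation is invisible to \<open>w\<close>, which vanishes on every face whose
  complement lies outside \<open>P\<close>.\<close>

lemma pairing_rel_bd:
  assumes "w \<in> simplicial_chains (complements P) j"
  shows "pairing (rel_bd P z) w = pairing z (bd w)"
proof -
  have "pairing (rel_bd P z) w = pairing (bd z) w"
    unfolding pairing_def
    by (rule sum.cong) (use assms in \<open>auto simp: rel_bd_def restrict_to_def simplicial_chains_def complements_def\<close>)
  then show ?thesis by (simp add: pairing_bd)
qed

text \<open>Over a field, the image of an operator is the annihilator of the kernel of its adjoint.
  If \<open>z\<close> annihilates cycles, then \<open>bd w\<close> determines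
  \<open>pairing z w\<close>; a chain representing the resulting functional has boundary
  \<open>z\<close>.\<close>

lemma rel_boundaries_iff_pairing:
  assumes P: "P \<subseteq> Pow A" and up: "\<And>\<sigma> \<tau>. \<sigma> \<in> P \<Longrightarrow> \<sigma> \<subseteq> \<tau> \<Longrightarrow> \<tau> \<subseteq> A \<Longrightarrow> \<tau> \<in> P"
    and z: "z \<in> simplicial_chains P m" and j: "j = int (card A) - m - 2"
  shows "z \<in> rel_boundaries P m \<longleftrightarrow> (\<forall>w \<in> rel_cycles (complements P) j. pairing z w = 0)"
proof -
  let ?C = "simplicial_chains (complements P) :: int \<Rightarrow> ('v set \<Rightarrow> 'a) set"
  \<comment> \<open>Complements of an upward closed family form a simplicial complex, where
    truncation has no effect.\<close>
  have bdC: "bd w \<in> ?C (j - 1)" and rel: "rel_bd (complements P) w = bd w" if w: "w \<in> ?C j" for w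
  proof -
    have "boundary r w \<in> ?C (j - 1)"
    proof (rule boundary_chains)
      fix \<sigma> \<tau> assume "\<sigma> \<in> complements P" "\<tau> \<subseteq> \<sigma>"
      then show "\<tau> \<in> complements P" using up[of "A - \<sigma>" "A - \<tau>"] by (auto simp: complements_def)
    qed (use w in simp)
    then show "bd w \<in> ?C (j - 1)" by (simp add: boundary_eq_bd[OF w complements_subset])
    then show "rel_bd (complements P) w = bd w" by (simp add: rel_bd_def restrict_to_chain)
  qed
  show ?thesis
  proof
    assume "z \<in> rel_boundaries P m"
    then obtain y where "z = rel_bd P y" by (auto simp: rel_boundaries_def)
    then show "\<forall>w \<in> rel_cycles (complements P) j. pairing z w = 0"
      by (auto simp: rel_cycles_def rel pairing_rel_bd functionals.linear_0[OF functional_pairing_right])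
  next
    assume *: "\<forall>w \<in> rel_cycles (complements P) j. pairing z w = 0"
    \<comment> \<open>A preimage under \<open>bd\<close> is chosen arbitrarily; two preimages differ
      by a cycle, which \<open>z\<close> annihilates.\<close>
    define l where "l u = pairing z (SOME w. w \<in> ?C j \<and> bd w = u)" for u
    have l: "l (bd w) = pairing z w" if w: "w \<in> ?C j" for w
    proof -
      define w' where "w' = (SOME w'. w' \<in> ?C j \<and> bd w' = bd w)"
      have w': "w' \<in> ?C j" "bd w' = bd w"
        using someI[of "\<lambda>w'. w' \<in> ?C j \<and> bd w' = bd w" w] w unfolding w'_def by auto
      have "w' - w \<in> ?C j" using w w' by (intro fun_space.subspace_diff subspace_chains)
      moreover from this have "rel_bd (complements P) (w' - w) = 0"
        using rel w' by (simp only: fun_maps.linear_diff[OF linear_bd]) simp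
      ultimately have "pairing z (w' - w) = 0" using * unfolding rel_cycles_def by blast
      then show ?thesis
        by (simp add: l_def w'_def[symmetric] functionals.linear_diff[OF functional_pairing_right]
            del: minus_apply)
    qed
    have W: "fun_space.subspace (bd ` ?C j)"
      by (rule fun_maps.linear_subspace_image[OF linear_bd subspace_chains])
    have add: "l (u + v) = l u + l v" if "u \<in> bd ` ?C j" "v \<in> bd ` ?C j" for u v
    proof -
      from that
      obtain x y where xy: "x \<in> ?C j" "u = bd x" "y \<in> ?C j" "v = bd y" by auto
      then show ?thesis
        using l[OF fun_space.subspace_add[OF subspace_chains xy(1,3)]] l
        by (simp only: fun_maps.linear_add[OF linear_bd] functionals.linear_add[OF functional_pairing_right])
    qed
    have scale: "l (fun_scale c u) = c * l u" if "u \<in> bd ` ?C j" for c u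
    proof -
      from that obtain x where x: "x \<in> ?C j" "u = bd x" by auto
      then show ?thesis
        using l[OF fun_space.subspace_scale[OF subspace_chains x(1), of c]] l
        by (simp only: fun_maps.linear_scale[OF linear_bd] functionals.linear_scale[OF functional_pairing_right])
    qed
    obtain L where L: "functional L" "\<And>u. u \<in> bd ` ?C j \<Longrightarrow> L u = l u"
      using functional_extension[OF W, of l] add scale by blast
    \<comment> \<open>The functional acts on chains of degree \<open>j - 1\<close>, whose
      complementary degree is \<open>m + 1\<close>.\<close>
    define y where "y = dual_chain P (m + 1) L"
    have y: "y \<in> simplicial_chains P (m + 1)"
      unfolding y_def by (rule dual_chain_chains[OF P])
    have "rel_bd P y - z = 0"
    proof (rule pairing_nondegenerate)
      show "rel_bd P y - z \<in> simplicial_chains P m"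
        by (rule fun_space.subspace_diff[OF subspace_chains rel_bd_chains[OF y P] z])
      fix w assume "w \<in> ?C (int (card A) - m - 2)"
      then have w: "w \<in> ?C j" by (simp add: j)
      have "pairing (rel_bd P y) w = L (bd w)"
        unfolding pairing_rel_bd[OF w] y_def
        by (rule pairing_dual_chain[OF L(1)]) (use bdC[OF w] in \<open>simp add: j algebra_simps\<close>)
      also have "\<dots> = pairing z w" using L(2) l w by simp
      finally show "pairing (rel_bd P y - z) w = 0"
        unfolding functionals.linear_diff[OF functional_pairing_left] by simp
    qed (rule P)
    then have "z = rel_bd P y" by simp
    then show "z \<in> rel_boundaries P m" using y by (auto simp: rel_boundaries_def)
  qed
qed

text \<open>The chain dual to \<open>L\<close> is a cycle: its relative boundary pairs with
  \<open>g\<close> to the value of \<open>L\<close> on the boundary of \<open>g\<close>, which is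
  zero, and the pairing is nondegenerate.\<close>

lemma pairing_represents:
  assumes P: "P \<subseteq> Pow A" and L: "functional L" and j: "j = int (card A) - m - 2"
    and L0: "\<And>g. g \<in> simplicial_chains (complements P) (j + 1) \<Longrightarrow> L (rel_bd (complements P) g) = 0"
    and up: "\<And>\<sigma> \<tau>. \<sigma> \<in> P \<Longrightarrow> \<sigma> \<subseteq> \<tau> \<Longrightarrow> \<tau> \<subseteq> A \<Longrightarrow> \<tau> \<in> P"
  shows "\<exists>z \<in> rel_cycles P m. \<forall>w \<in> simplicial_chains (complements P) j. pairing z w = L w"
proof (rule bexI, rule ballI)
  let ?C = "simplicial_chains (complements P) :: int \<Rightarrow> ('v set \<Rightarrow> 'a) set"
  show rep: "pairing (dual_chain P m L) w = L w" if "w \<in> ?C j" for w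
    using pairing_dual_chain[OF L] that by (simp add: j)
  have zC: "dual_chain P m L \<in> simplicial_chains P m" by (rule dual_chain_chains[OF P])
  have "rel_bd P (dual_chain P m L) = 0"
  proof (rule pairing_nondegenerate)
    show "rel_bd P (dual_chain P m L) \<in> simplicial_chains P (m - 1)"
      using rel_bd_chains[of _ P "m - 1"] zC P by simp
    fix g assume "g \<in> ?C (int (card A) - (m - 1) - 2)"
    then have g: "g \<in> ?C (j + 1)" by (simp add: j algebra_simps)
    have "boundary r g \<in> ?C j"
    proof (rule boundary_chains[OF g])
      fix \<sigma> \<tau> assume "\<sigma> \<in> complements P" "\<tau> \<subseteq> \<sigma>"
      then show "\<tau> \<in> complements P" using up[of "A - \<sigma>" "A - \<tau>"] by (auto simp: complements_def)
    qed
    then have bg: "bd g \<in> ?C j" "rel_bd (complements P) g = bd g"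
      by (simp_all add: boundary_eq_bd[OF g complements_subset] rel_bd_def restrict_to_chain)
    then show "pairing (rel_bd P (dual_chain P m L)) g = 0"
      using L0[OF g] by (simp add: pairing_rel_bd[OF g] rep)
  qed (rule P)
  then show "dual_chain P m L \<in> rel_cycles P m" using zC by (simp add: rel_cycles_def)
qed

section \<open>Passage to reduced simplicial homology\<close>

lemma simplicial_eq_rel:
  assumes \<Delta>: "\<Delta> \<subseteq> Pow A" and down: "\<And>\<sigma> \<tau>. \<sigma> \<in> \<Delta> \<Longrightarrow> \<tau> \<subseteq> \<sigma> \<Longrightarrow> \<tau> \<in> \<Delta>"
  shows "simplicial_cycles r \<Delta> i = (rel_cycles \<Delta> i :: ('v set \<Rightarrow> 'k::field) set)"
    and "simplicial_boundaries r \<Delta> i = (rel_boundaries \<Delta> i :: ('v set \<Rightarrow> 'k::field) set)"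
proof -
  \<comment> \<open>The boundary of a chain of a complex stays in the complex, so truncation leaves
    it unchanged.\<close>
  have eq: "boundary r f = rel_bd \<Delta> f" if f: "f \<in> simplicial_chains \<Delta> j" for f :: "'v set \<Rightarrow> 'k" and j
  proof -
    have "boundary r f \<in> simplicial_chains \<Delta> (j - 1)"
      by (rule boundary_chains) (use f down in auto)
    then show ?thesis
      using restrict_to_chain[of "boundary r f" \<Delta>] by (simp add: rel_bd_def boundary_eq_bd[OF f \<Delta>])
  qed
  then show "simplicial_cycles r \<Delta> i = (rel_cycles \<Delta> i :: ('v set \<Rightarrow> 'k) set)"
    by (auto simp: simplicial_cycles_def rel_cycles_def zero_fun_def)
  show "simplicial_boundaries r \<Delta> i = (rel_boundaries \<Delta> i :: ('v set \<Rightarrow> 'k) set)"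
    unfolding simplicial_boundaries_def rel_boundaries_def by (intro image_cong refl eq)
qed

text \<open>\<open>complements P\<close> is the Alexander dual of the complex
  \<open>Pow A - P\<close>. Transporting cycles of \<Delta> to \<open>P\<close> along the given
  isomorphism and then pairing yields the form that identifies homology with a dual.\<close>

lemma module_isomorphic_dual_complements:
  assumes \<Delta>: "\<Delta> \<subseteq> Pow A" and down: "\<And>\<sigma> \<tau>. \<sigma> \<in> \<Delta> \<Longrightarrow> \<tau> \<subseteq> \<sigma> \<Longrightarrow> \<tau> \<in> \<Delta>"
    and P: "P \<subseteq> Pow A" and up: "\<And>\<sigma> \<tau>. \<sigma> \<in> P \<Longrightarrow> \<sigma> \<subseteq> \<tau> \<Longrightarrow> \<tau> \<subseteq> A \<Longrightarrow> \<tau> \<in> P"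
    and iso: "subquotient_iso (rel_cycles \<Delta> i) (rel_boundaries \<Delta> i :: ('v set \<Rightarrow> 'k::field) set)
      (rel_cycles P m) (rel_boundaries P m :: ('v set \<Rightarrow> 'k) set)"
    and j: "j = int (card A) - m - 2"
  shows "module_isomorphic (ring_of_type_algebra :: 'k ring) (reduced_homology r \<Delta> i)
     (dual_module (ring_of_type_algebra :: 'k ring) (reduced_homology r (complements P) j))"
proof -
  let ?D = "complements P"
  have downD: "\<tau> \<in> ?D" if "\<sigma> \<in> ?D" "\<tau> \<subseteq> \<sigma>" for \<sigma> \<tau>
    using up[of "A - \<sigma>" "A - \<tau>"] that by (auto simp: complements_def)
  obtain \<phi> where \<phi>: "linear_fun \<phi>" "\<And>z. z \<in> rel_cycles \<Delta> i \<Longrightarrow> \<phi> z \<in> rel_cycles P m"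
    "\<And>z. z \<in> rel_cycles \<Delta> i \<Longrightarrow> \<phi> z \<in> rel_boundaries P m \<longleftrightarrow> (z :: 'v set \<Rightarrow> 'k) \<in> rel_boundaries \<Delta> i"
    "\<And>z'. z' \<in> rel_cycles P m \<Longrightarrow> \<exists>z\<in>rel_cycles \<Delta> i. z' - \<phi> z \<in> rel_boundaries P m"
    using iso unfolding subquotient_iso_def by blast
  have boundariesD: "rel_boundaries ?D j \<subseteq> (rel_cycles ?D j :: ('v set \<Rightarrow> 'k) set)"
    by (rule rel_boundaries_subset_cycles[OF complements_subset]) (rule downD)
  have boundaries\<Delta>: "rel_boundaries \<Delta> i \<subseteq> (rel_cycles \<Delta> i :: ('v set \<Rightarrow> 'k) set)"
    by (rule rel_boundaries_subset_cycles[OF \<Delta>]) (rule down)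
  have vanish: "pairing z w = 0" if z: "z \<in> rel_cycles P m" and w: "w \<in> rel_boundaries ?D j"
    for z w :: "'v set \<Rightarrow> 'k"
  proof -
    obtain g where g: "g \<in> simplicial_chains ?D (j + 1)" "w = rel_bd ?D g"
      using w by (auto simp: rel_boundaries_def)
    have "w = boundary r g"
    proof -
      have "boundary r g \<in> simplicial_chains ?D j"
        by (rule boundary_chains[OF g(1)]) (rule downD)
      then show ?thesis
        using g(2) restrict_to_chain[of "boundary r g" ?D]
        by (simp add: rel_bd_def boundary_eq_bd[OF g(1) complements_subset])
    qed
    then have "pairing z w = pairing (rel_bd P z) g"
      by (simp add: pairing_rel_bd[OF g(1)] boundary_eq_bd[OF g(1) complements_subset])
    then show ?thesis
      using z functionals.linear_0[OF functional_pairing_left] by (simp add: rel_cycles_def)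
  qed
  have iff: "y \<in> rel_boundaries P m \<longleftrightarrow> (\<forall>w \<in> rel_cycles ?D j. pairing y w = 0)"
    if "y \<in> simplicial_chains P m" for y :: "'v set \<Rightarrow> 'k"
    using that by (intro rel_boundaries_iff_pairing[OF P _ _ j]) (rule up)
  have eq: "simplicial_cycles r \<Delta> i = (rel_cycles \<Delta> i :: ('v set \<Rightarrow> 'k) set)"
    "simplicial_boundaries r \<Delta> i = (rel_boundaries \<Delta> i :: ('v set \<Rightarrow> 'k) set)"
    "simplicial_cycles r ?D j = (rel_cycles ?D j :: ('v set \<Rightarrow> 'k) set)"
    "simplicial_boundaries r ?D j = (rel_boundaries ?D j :: ('v set \<Rightarrow> 'k) set)"
    using simplicial_eq_rel[OF \<Delta>, where 'k='k] simplicial_eq_rel[OF complements_subset, where 'k='k] down downD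
    by blast+
  show ?thesis
  proof (rule module_isomorphic_dual_homologyI[where \<beta> = "\<lambda>z w. pairing (\<phi> z) w"
        and r = r and \<Delta> = \<Delta> and i = i and \<Delta>' = "complements P" and j = j, unfolded eq])
    show "functional (\<lambda>z. pairing (\<phi> z) w)" for w
      using Vector_Spaces.linear_compose[OF \<phi>(1) functional_pairing_left[of w]] by (simp add: comp_def)
    show "functional (pairing (\<phi> z))" for z by (rule functional_pairing_right)
    show "pairing (\<phi> z) w = 0" if "z \<in> rel_cycles \<Delta> i" "w \<in> rel_boundaries ?D j" for z w
      by (rule vanish) (use that \<phi>(2) in auto)
    show "(\<forall>w\<in>rel_cycles ?D j. pairing (\<phi> z) w = 0) \<longleftrightarrow> z \<in> rel_boundaries \<Delta> i"
      if z: "z \<in> rel_cycles \<Delta> i" for z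
    proof -
      have "\<phi> z \<in> simplicial_chains P m" using \<phi>(2)[OF z] by (simp add: rel_cycles_def)
      then show ?thesis
        using iff[of "\<phi> z"] \<phi>(3)[OF z] by blast
    qed
    show "\<exists>z\<in>rel_cycles \<Delta> i. \<forall>w\<in>rel_cycles ?D j. pairing (\<phi> z) w = L w"
      if L: "functional L" "\<And>w. w \<in> rel_boundaries ?D j \<Longrightarrow> L w = 0" for L
    proof -
      have "\<exists>z' \<in> rel_cycles P m. \<forall>w \<in> simplicial_chains ?D j. pairing z' w = L w"
      proof (rule pairing_represents[OF P L(1) j])
        show "L (rel_bd ?D g) = 0" if "g \<in> simplicial_chains ?D (j + 1)" for g
          using that by (intro L(2)) (simp add: rel_boundaries_def)
      qed (rule up)
      then obtain z' where z': "z' \<in> rel_cycles P m" "\<And>w. w \<in> simplicial_chains ?D j \<Longrightarrow> pairing z' w = L w"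
        by blast
      obtain z where z: "z \<in> rel_cycles \<Delta> i" "z' - \<phi> z \<in> rel_boundaries P m"
        using \<phi>(4)[OF z'(1)] by blast
      have "z' - \<phi> z \<in> simplicial_chains P m"
        using z' \<phi>(2)[OF z(1)] fun_space.subspace_diff[OF subspace_chains] by (auto simp: rel_cycles_def)
      \<comment> \<open>Replacing \<open>z'\<close> by \<open>\<phi> z\<close> changes it by a
        relative boundary, which pairs to zero with cycles.\<close>
      then have "\<forall>w\<in>rel_cycles ?D j. pairing (z' - \<phi> z) w = 0"
        using iff z(2) by blast
      then show ?thesis
        using z(1) z'(2) unfolding functionals.linear_diff[OF functional_pairing_left]
        by (intro bexI[of _ z]) (auto simp: rel_cycles_def)
    qed
  qed (fact subspace_rel_cycles subspace_rel_boundaries boundariesD boundaries\<Delta>)+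
qed

end

section \<open>Pile complexes\<close>

text \<open>This is the family \<open>F J\<close> of the opening explanation.\<close>

definition mixed_family :: "(int ^ 'd) set \<Rightarrow> int ^ 'd \<Rightarrow> 'd set \<Rightarrow> (int ^ 'd) set set" where
  "mixed_family A c J = {S. S \<subseteq> A \<and> (\<forall>j\<in>J. c $ j < (\<Sum>a\<in>S. a) $ j) \<and> (\<forall>j. j \<notin> J \<longrightarrow> (\<Sum>a\<in>S. a) $ j \<le> c $ j)}"

lemma sum_component_mono:
  fixes A :: "(int ^ 'd) set"
  assumes "finite A" "\<forall>a\<in>A. 0 \<le> a" "S \<subseteq> T" "T \<subseteq> A"
  shows "(\<Sum>a\<in>S. a) $ j \<le> (\<Sum>a\<in>T. a) $ j"
proof -
  have "(\<Sum>a\<in>S. a $ j) \<le> (\<Sum>a\<in>T. a $ j)"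
    by (rule sum_mono2) (use assms in \<open>auto simp: less_eq_vec_def intro: finite_subset\<close>)
  then show ?thesis by simp
qed

lemma mixed_family_empty: "mixed_family A c {} = pile_complex A c"
  by (auto simp: mixed_family_def pile_complex_def less_eq_vec_def)

text \<open>Over the integers a strict inequality is a weak one shifted by 1; this is where the
  all-ones vector in the dual bound comes from.\<close>

lemma complements_mixed_family:
  fixes A :: "(int ^ 'd::finite) set"
  assumes "finite A"
  shows "{S. S \<subseteq> A \<and> A - S \<in> mixed_family A c UNIV} = pile_complex A ((\<Sum>a\<in>A. a) - c - 1)"
proof -
  have "(\<forall>j. c $ j < (\<Sum>a\<in>A - S. a) $ j) \<longleftrightarrow> (\<Sum>a\<in>S. a) \<le> (\<Sum>a\<in>A. a) - c - 1" if "S \<subseteq> A" for S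
  proof -
    have "(\<Sum>a\<in>A - S. a) = (\<Sum>a\<in>A. a) - (\<Sum>a\<in>S. a)" using assms that by (rule sum_diff)
    then have "c $ j < (\<Sum>a\<in>A - S. a) $ j \<longleftrightarrow> (\<Sum>a\<in>S. a) $ j \<le> ((\<Sum>a\<in>A. a) - c - 1) $ j" for j
      by (simp only: vector_minus_component one_index) linarith
    then show ?thesis by (simp only: less_eq_vec_def)
  qed
  then show ?thesis by (auto simp: mixed_family_def pile_complex_def)
qed

text \<open>The axis is an extreme ray of the orthant, and \<open>A\<close> lies in the orthant.\<close>

lemma axis_generator:
  fixes A :: "(int ^ 'd::finite) set"
  assumes "finite A" "\<forall>a\<in>A. 0 \<le> a"
    and cone: "{x :: real ^ 'd. \<forall>j. x $ j \<in> \<nat>} \<subseteq> convex_cone hull (real_vec ` A)"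
  obtains a where "a \<in> A" "\<And>k. k \<noteq> j \<Longrightarrow> a $ k = 0"
proof -
  have "axis j 1 \<in> {x :: real ^ 'd. \<forall>j. x $ j \<in> \<nat>}" by (auto simp: axis_def)
  with cone have "axis j 1 \<in> convex_cone hull (real_vec ` A)" by blast
  then obtain u where u: "axis j 1 = (\<Sum>s\<in>real_vec ` A. u s *\<^sub>R s)" "\<forall>s\<in>real_vec ` A. 0 \<le> u s"
    using assms(1) by (auto simp: convex_cone_hull_finite)
  have comp: "axis j (1::real) $ k = (\<Sum>s\<in>real_vec ` A. u s * s $ k)" for k
    by (simp add: u(1))
  have nonneg: "0 \<le> s $ k" if "s \<in> real_vec ` A" for s k
    using that assms(2) by (auto simp: real_vec_def less_eq_vec_def)
  have "(\<Sum>s\<in>real_vec ` A. u s * s $ j) \<noteq> 0" using comp[of j] by simp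
  then obtain s where s: "s \<in> real_vec ` A" "u s \<noteq> 0"
    by (metis (no_types, lifting) mult_zero_left sum.neutral)
  then obtain a where a: "a \<in> A" "s = real_vec a" by auto
  have "a $ k = 0" if "k \<noteq> j" for k
  proof -
    \<comment> \<open>All terms are nonnegative with sum zero, so each vanishes; since
      \<open>u s\<close> is nonzero, the component of \<open>a\<close> is zero.\<close>
    have "(\<Sum>s\<in>real_vec ` A. u s * s $ k) = 0" using comp[of k] that by (simp add: axis_def)
    then have "u s * s $ k = 0"
      using s(1) assms(1) u(2) nonneg by (subst (asm) sum_nonneg_eq_0_iff) auto
    then show ?thesis using s(2) a by (simp add: real_vec_def)
  qed
  with a that show thesis by blast
qed

text \<open>Induction on \<open>J\<close>: each new coordinate switches from the weak to the strict
  inequality at the cost of one degree.\<close>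

lemma mixed_family_iso:
  fixes A :: "(int ^ 'd::finite) set"
  assumes "ordered_vertices A r" and nonneg: "\<forall>a\<in>A. 0 \<le> a"
    and cone: "{x :: real ^ 'd. \<forall>j. x $ j \<in> \<nat>} \<subseteq> convex_cone hull (real_vec ` A)"
  defines "Z \<equiv> ordered_vertices.rel_cycles A r :: _ \<Rightarrow> _ \<Rightarrow> ((int ^ 'd) set \<Rightarrow> 'k::field) set"
    and "B \<equiv> ordered_vertices.rel_boundaries A r :: _ \<Rightarrow> _ \<Rightarrow> ((int ^ 'd) set \<Rightarrow> 'k::field) set"
  shows "subquotient_iso (Z (mixed_family A c {}) i) (B (mixed_family A c {}) i)
    (Z (mixed_family A c J) (i + int (card J))) (B (mixed_family A c J) (i + int (card J)))"
proof -
  interpret ordered_vertices A r by fact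
  note mono = sum_component_mono[OF finite_vertices nonneg]
  have "finite J" by simp
  then show ?thesis
  proof (induction J)
    case empty
    then show ?case
      unfolding Z_def B_def by (simp add: subquotient_iso_refl subspace_rel_boundaries)
  next
    case (insert j J)
    obtain a where a: "a \<in> A" "\<And>k. k \<noteq> j \<Longrightarrow> a $ k = 0"
      using axis_generator[OF finite_vertices nonneg cone] by blast
    \<comment> \<open>Coordinate \<open>j\<close> is left free, and \<open>a\<close> can change only
      this coordinate of a sum, so adding or removing \<open>a\<close> preserves
      \<open>Q\<close>.\<close>
    define Q where "Q = {S. S \<subseteq> A \<and> (\<forall>k\<in>J. c $ k < (\<Sum>a\<in>S. a) $ k) \<and>
      (\<forall>k. k \<notin> insert j J \<longrightarrow> (\<Sum>a\<in>S. a) $ k \<le> c $ k)}"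
    have Q_cong: "T \<in> Q" if "S \<in> Q" "T \<subseteq> A" "\<And>k. k \<noteq> j \<Longrightarrow> (\<Sum>a\<in>T. a) $ k = (\<Sum>a\<in>S. a) $ k" for S T
      using that \<open>j \<notin> J\<close> by (auto simp: Q_def) (metis (no_types, lifting))
    have toggle: "(\<Sum>a\<in>insert a S. a) $ k = (\<Sum>a\<in>S - {a}. a) $ k" if "S \<subseteq> A" "k \<noteq> j" for S k
      using that a(2)[of k] finite_subset[OF that(1) finite_vertices]
      by (subst sum.insert_remove) auto
    have toggle': "(\<Sum>a\<in>insert a S. a) $ k = (\<Sum>a\<in>S. a) $ k \<and> (\<Sum>a\<in>S - {a}. a) $ k = (\<Sum>a\<in>S. a) $ k"
      if "S \<subseteq> A" "k \<noteq> j" for S k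
      using toggle[OF that] by (cases "a \<in> S") (simp_all add: insert_absorb del: sum_component)
    have step: "subquotient_iso (Z (mixed_family A c J) (i + int (card J))) (B (mixed_family A c J) (i + int (card J)))
      (Z (mixed_family A c (insert j J)) (i + int (card J) + 1)) (B (mixed_family A c (insert j J)) (i + int (card J) + 1))"
      unfolding Z_def B_def
    proof (rule connecting_iso[of Q a])
      show "Q \<subseteq> Pow A" by (auto simp: Q_def)
      show "\<sigma> \<in> Q" if "\<tau> \<in> Q" "\<rho> \<in> Q" "\<tau> \<subseteq> \<sigma>" "\<sigma> \<subseteq> \<rho>" for \<tau> \<sigma> \<rho>
      proof -
        have "\<sigma> \<subseteq> A" "\<rho> \<subseteq> A" using that by (auto simp: Q_def)
        then have "(\<Sum>a\<in>\<tau>. a) $ k \<le> (\<Sum>a\<in>\<sigma>. a) $ k" "(\<Sum>a\<in>\<sigma>. a) $ k \<le> (\<Sum>a\<in>\<rho>. a) $ k" for k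
          using mono that by blast+
        then show ?thesis
          using that \<open>\<sigma> \<subseteq> A\<close> unfolding Q_def by (blast intro: less_le_trans order_trans)
      qed
      show "a \<in> A" by fact
      show "insert a \<sigma> \<in> Q" "\<sigma> - {a} \<in> Q" if "\<sigma> \<in> Q" for \<sigma>
      proof -
        have "\<sigma> \<subseteq> A" using that by (auto simp: Q_def)
        then show "insert a \<sigma> \<in> Q" "\<sigma> - {a} \<in> Q"
          using toggle' a(1) by (auto intro!: Q_cong[OF that])
      qed
      show "mixed_family A c J \<union> mixed_family A c (insert j J) = Q"
        using \<open>j \<notin> J\<close> by (auto simp: Q_def mixed_family_def not_less simp del: sum_component)
      show "mixed_family A c J \<inter> mixed_family A c (insert j J) = {}"
        using \<open>j \<notin> J\<close> by (force simp: mixed_family_def simp del: sum_component)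
      \<comment> \<open>Passing to a subset can only lower the sum in coordinate \<open>j\<close>,
        so its upper bound persists; membership in \<open>Q\<close> supplies the other
        conditions.\<close>
      show "\<tau> \<in> mixed_family A c J" if "\<sigma> \<in> mixed_family A c J" "\<tau> \<in> Q" "\<tau> \<subseteq> \<sigma>" for \<sigma> \<tau>
      proof -
        have "\<sigma> \<subseteq> A" using that by (auto simp: mixed_family_def)
        then have "(\<Sum>a\<in>\<tau>. a) $ k \<le> (\<Sum>a\<in>\<sigma>. a) $ k" for k
          using mono that by blast
        then show ?thesis
          using that unfolding mixed_family_def Q_def by (blast intro: order_trans)
      qed
    qed
    \<comment> \<open>Convexity holds because strict lower bounds pass to larger sets and upper
      bounds to smaller ones.\<close>
    have sub: "B (mixed_family A c J) (i + int (card J)) \<subseteq> Z (mixed_family A c J) (i + int (card J))"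
      unfolding Z_def B_def
    proof (rule rel_boundaries_subset_cycles)
      show "mixed_family A c J \<subseteq> Pow A" by (auto simp: mixed_family_def)
      show "\<sigma> \<in> mixed_family A c J"
        if "\<tau> \<in> mixed_family A c J" "\<rho> \<in> mixed_family A c J" "\<tau> \<subseteq> \<sigma>" "\<sigma> \<subseteq> \<rho>" for \<tau> \<sigma> \<rho>
      proof -
        have "\<sigma> \<subseteq> A" "\<rho> \<subseteq> A" using that by (auto simp: mixed_family_def)
        then have "(\<Sum>a\<in>\<tau>. a) $ k \<le> (\<Sum>a\<in>\<sigma>. a) $ k" "(\<Sum>a\<in>\<sigma>. a) $ k \<le> (\<Sum>a\<in>\<rho>. a) $ k" for k
          using mono that by blast+
        then show ?thesis
          using that \<open>\<sigma> \<subseteq> A\<close> unfolding mixed_family_def by (blast intro: less_le_trans order_trans)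
      qed
    qed
    have "subquotient_iso (Z (mixed_family A c {}) i) (B (mixed_family A c {}) i)
      (Z (mixed_family A c (insert j J)) (i + int (card J) + 1)) (B (mixed_family A c (insert j J)) (i + int (card J) + 1))"
      by (rule subquotient_iso_trans[OF insert.IH step _ sub]) (simp add: B_def subspace_rel_boundaries)
    then show ?case using insert.hyps by (simp add: algebra_simps)
  qed
qed

theorem theorem1:
  fixes c :: "int ^ 'd::finite"
    and A :: "(int ^ 'd) set"
    and n N :: nat
    and i :: int
    and r :: "(int ^ 'd) rel"
  assumes "CARD('d) = n + 1"
    and "finite A"
    and "card A = N + 1"
    and "\<forall>a\<in>A. 0 \<le> a"
    and "{x :: real ^ 'd. \<forall>j. x $ j \<in> \<nat>} \<subseteq> convex_cone hull (real_vec ` A)"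
    and "linear_order_on A r"
  defines "t \<equiv> \<Sum>a\<in>A. a"
  defines "c' \<equiv> t - c - 1"
  shows "module_isomorphic (ring_of_type_algebra :: 'k::field ring)
     (reduced_homology r (pile_complex A c) (i - 1))
     (dual_module (ring_of_type_algebra :: 'k ring)
        (reduced_homology r (pile_complex A c') (int N - int n - i - 1)))"
proof -
  interpret ordered_vertices A r using assms by unfold_locales
  let ?P = "mixed_family A c UNIV"
  have "complements ?P = pile_complex A c'"
    unfolding complements_def c'_def t_def by (rule complements_mixed_family[OF \<open>finite A\<close>])
  moreover have "module_isomorphic (ring_of_type_algebra :: 'k ring)
     (reduced_homology r (pile_complex A c) (i - 1))
     (dual_module (ring_of_type_algebra :: 'k ring)
        (reduced_homology r (complements ?P) (int N - int n - i - 1)))"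
  proof (rule module_isomorphic_dual_complements)
    show "pile_complex A c \<subseteq> Pow A" by (auto simp: pile_complex_def)
    show "\<tau> \<in> pile_complex A c" if "\<sigma> \<in> pile_complex A c" "\<tau> \<subseteq> \<sigma>" for \<sigma> \<tau>
      by (rule pile_complex_down_closed[OF assms(2) _ that]) (use assms(4) in auto)
    show "?P \<subseteq> Pow A" by (auto simp: mixed_family_def)
    show "\<tau> \<in> ?P" if "\<sigma> \<in> ?P" "\<sigma> \<subseteq> \<tau>" "\<tau> \<subseteq> A" for \<sigma> \<tau>
    proof -
      have "(\<Sum>a\<in>\<sigma>. a) $ k \<le> (\<Sum>a\<in>\<tau>. a) $ k" for k
        by (rule sum_component_mono[OF assms(2,4) that(2,3)])
      then show ?thesis using that unfolding mixed_family_def by (blast intro: less_le_trans)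
    qed
    \<comment> \<open>There are \<open>n + 1\<close> coordinates, so degree \<open>i - 1\<close>
      moves to \<open>i + n\<close>.\<close>
    show "subquotient_iso (rel_cycles (pile_complex A c) (i - 1))
      (rel_boundaries (pile_complex A c) (i - 1) :: ((int ^ 'd) set \<Rightarrow> 'k) set)
      (rel_cycles ?P (i + int n)) (rel_boundaries ?P (i + int n) :: ((int ^ 'd) set \<Rightarrow> 'k) set)"
      using mixed_family_iso[OF ordered_vertices_axioms assms(4,5), of c "i - 1" UNIV] assms(1)
      by (simp add: mixed_family_empty)
    \<comment> \<open>Degrees of complementary faces add up to \<open>card A - 2\<close>, which is
      \<open>N - 1\<close>.\<close>
    show "int N - int n - i - 1 = int (card A) - (i + int n) - 2"
      using assms(3) by simp
  qed
  ultimately show ?thesis by simp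
qed

end
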